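(* Let $k\in\mathbb{N}$ and let $(\Lambda,d)$ be a proper topological $k$-graph without sources. Then the boundary-path groupoid $\mathcal{G}_\Lambda$ is amenable.
   Context: Conventions: $\mathbb{N}=\{0,1,2,\dots\}$; $e_1,\dots,e_k$ are the standard generators of $\mathbb{N}^k$; on $(\mathbb{N}\cup\{\infty\})^k$, $\le$ is the coordinatewise order and $\vee,\wedge$ are coordinatewise max and min. Topological $k$-graph ($k\in\mathbb{N}$): a pair $(\Lambda,d)$ of a small category $\Lambda$ (range = codomain map $r$, source = domain map $s$; $\lambda\mu$ is defined when $s(\lambda)=r(\mu)$) and a functor $d:\Lambda\to\mathbb{N}^k$ such that: (1) the object and morphism sets are second-countable locally compact Hausdorff spaces; (2) $r,s$ are continuous and $s$ is a local homeomorphism; (3) composition, from the set of composable pairs with the relative product topology, is continuous and open; (4) $d$ is continuous, $\mathbb{N}^k$ being discrete; (5) if $d(\lambda)=m+n$ there is a unique composable pair $(\xi,\eta)$ with $\lambda=\xi\eta$, $d(\xi)=m$, $d(\eta)=n$. $\Lambda$ also denotes the morphism set, objects are identified with identity morphisms, $\Lambda^m:=d^{-1}(\{m\})$ (so $\Lambda^0$ is the object set), $UV:=\{\lambda\mu:\lambda\in U,\mu\in V,s(\lambda)=r(\mu)\}$ for $U,V\subset\Lambda$, and $v\Lambda^m:=\{v\}\Lambda^m$. $\Lambda$ is proper if for all $m\in\mathbb{N}^k$ and compact $U\subset\Lambda^0$, $U\Lambda^m$ is compact. A vertex $v\in\Lambda^0$ is a source if $v\Lambda^{e_i}=\emptyset$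 for some $i\in\{1,\dots,k\}$; "without sources" means no vertex is a source. (A proper topological $k$-graph is compactly aligned: for all $p,q$ and compact $U\subset\Lambda^p$, $V\subset\Lambda^q$, the set $U\Lambda^{(p\vee q)-p}\cap V\Lambda^{(p\vee q)-q}$ is compact; hence $\mathcal{G}_\Lambda$ below is a locally compact topological groupoid.) Path space: for $m\in(\mathbb{N}\cup\{\infty\})^k$ let $\Omega_{k,m}$ be the discrete topological $k$-graph with objects $\{p\in\mathbb{N}^k:p\le m\}$, morphisms $\{(p,q)\in\mathbb{N}^k\times\mathbb{N}^k:p\le q\le m\}$, $r(p,q)=p$, $s(p,q)=q$, $(n,p)(p,q)=(n,q)$, $d(p,q)=q-p$. $X_\Lambda$ is the set of all degree-preserving (continuous) functors $x:\Omega_{k,m}\to\Lambda$, $m\in(\mathbb{N}\cup\{\infty\})^k$; put $d(x)=m$, $r(x)=x(0)$. For $m\in\mathbb{N}^k$, $m\le d(x)$, $\sigma^mx\in X_\Lambda$ has degree $d(x)-m$ and $(\sigma^mx)(0,p)=x(m,m+p)$; for $\lambda\in\Lambda$ with $s(\lambda)=r(x)$, $\lambda x\in X_\Lambda$ has degree $d(\lambda)+d(x)$, $(\lambda x)(0,d(\lambda))=\lambda$ and $\sigma^{d(\lambda)}(\lambda x)=x$. Path groupoid $G_\Lambda$: let $\Lambda*_s\Lambda:=\{(\lambda,\mu)\in\Lambda\times\Lambda:s(\lambda)=s(\mu)\}$ and $U*_sV:=(U\times V)\cap(\Lambda*_s\Lambda)$. $G_\Lambda$ has object set $X_\Lambda$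 and morphisms $(\lambda x,d(\lambda)-d(\mu),\mu x)\in X_\Lambda\times\mathbb{Z}^k\times X_\Lambda$ with $(\lambda,\mu)\in\Lambda*_s\Lambda$, $x\in X_\Lambda$, $r(x)=s(\lambda)$; $r(x,m,y)=x$, $s(x,m,y)=y$, $(x,m,y)(y,n,z)=(x,m+n,z)$, $(x,m,y)^{-1}=(y,-m,x)$; the unit $x$ is identified with $(x,0,x)$. For $F\subset\Lambda*_s\Lambda$, $m\in\mathbb{Z}^k$, let $Z(F,m):=\{(\lambda x,d(\lambda)-d(\mu),\mu x)\in G_\Lambda:(\lambda,\mu)\in F,\ d(\lambda)-d(\mu)=m\}$. The topology on $G_\Lambda$ has as basis the sets $Z(U*_sV,m)\cap Z(F,m)^c$ with $m\in\mathbb{Z}^k$, $U,V\subset\Lambda$ open, $F\subset\Lambda*_s\Lambda$ compact. Boundary paths: $\Lambda^{\min}(\lambda,\mu):=\{(\alpha,\beta):\lambda\alpha=\mu\beta,\ d(\lambda\alpha)=d(\lambda)\vee d(\mu)\}$. For $V\subset\Lambda^0$, a set $E\subset V\Lambda$ is exhaustive for $V$ if for every $\lambda\in V\Lambda$ there is $\mu\in E$ with $\Lambda^{\min}(\lambda,\mu)\neq\emptyset$. For $v\in\Lambda^0$, $v\mathcal{CE}(\Lambda)$ is the set of compact $E\subset\Lambda$ such that $r(E)$ is a neighbourhood of $v$ and $E$ is exhaustive for $r(E)$. $x\in X_\Lambda$ is a boundary path if for all $m\in\mathbb{N}^k$ with $m\le d(x)$ and all $E\in x(m)\mathcal{CE}(\Lambda)$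 there is $\lambda\in E$ with $x(m,m+d(\lambda))=\lambda$. $\partial\Lambda$ is the set of boundary paths (a closed invariant subset of $G_\Lambda^{(0)}=X_\Lambda$), and $\mathcal{G}_\Lambda:=G_\Lambda|_{\partial\Lambda}$ is the reduction, with the relative topology and Haar system of counting measures. Amenability is in the sense of Anantharaman-Delaroche and Renault (topological amenability): a locally compact groupoid $\Gamma$ is amenable if there is a net $(m_i)$, where each $m_i=(m_i^x)_{x\in\Gamma^{(0)}}$ is a family of probability measures with $m_i^x$ carried by $r^{-1}(x)$ and $x\mapsto\int f\,dm_i^x$ continuous for all $f\in C_c(\Gamma)$, such that $\|\gamma m_i^{s(\gamma)}-m_i^{r(\gamma)}\|_1\to0$ uniformly on compact subsets of $\Gamma$. *)

theory Defs
  imports "HOL-Probability.Probability_Measure" "HOL-Library.Function_Algebras" "HOL-Library.Extended_Nat"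
begin

section \<open>Degrees\<close>

text \<open>
  Since \<open>k = 0\<close> is allowed, elements of $\mathbb{N}^k$, $(\mathbb{N}\cup\{\infty\})^k$ and
  $\mathbb{Z}^k$ are functions on \<open>nat\<close> vanishing at all indices \<open>\<ge> k\<close>. Order, sum, difference
  and join (\<open>sup\<close>) are the pointwise ones on functions.
\<close>

definition degs :: "nat \<Rightarrow> (nat \<Rightarrow> 'b::zero) set" where
  "degs k = {m. \<forall>i\<ge>k. m i = 0}"

definition unit_deg :: "nat \<Rightarrow> nat \<Rightarrow> nat" where
  "unit_deg i = (\<lambda>j. if j = i then 1 else 0)"

abbreviation xdeg :: "(nat \<Rightarrow> nat) \<Rightarrow> nat \<Rightarrow> enat" where
  "xdeg m \<equiv> enat \<circ> m"

section \<open>Topological higher-rank graphs\<close>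

text \<open>
  Objects are identified with their identity morphisms, so both spaces live on one type and
  \<open>rng\<close>, \<open>src\<close> take values in the set of identities. The object space \<open>Obj\<close> nevertheless carries
  its own topology; it is not assumed to be a subspace of the morphism space \<open>Mor\<close>.
  \<open>cmp \<Lambda> a b\<close> is the product \<open>ab\<close>, meaningful when \<open>src \<Lambda> a = rng \<Lambda> b\<close>.
\<close>

record 'a kgraph =
  Obj :: "'a topology"
  Mor :: "'a topology"
  rng :: "'a \<Rightarrow> 'a"
  src :: "'a \<Rightarrow> 'a"
  cmp :: "'a \<Rightarrow> 'a \<Rightarrow> 'a"
  deg :: "'a \<Rightarrow> nat \<Rightarrow> nat"

abbreviation objs :: "'a kgraph \<Rightarrow> 'a set" where
  "objs \<Lambda> \<equiv> topspace (Obj \<Lambda>)"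

abbreviation mors :: "'a kgraph \<Rightarrow> 'a set" where
  "mors \<Lambda> \<equiv> topspace (Mor \<Lambda>)"

definition composable :: "'a kgraph \<Rightarrow> ('a \<times> 'a) set" where
  "composable \<Lambda> = {(a, b). a \<in> mors \<Lambda> \<and> b \<in> mors \<Lambda> \<and> src \<Lambda> a = rng \<Lambda> b}"

definition small_category :: "'a kgraph \<Rightarrow> bool" where
  "small_category \<Lambda> \<longleftrightarrow>
     objs \<Lambda> \<subseteq> mors \<Lambda> \<and>
     (\<forall>a\<in>mors \<Lambda>. rng \<Lambda> a \<in> objs \<Lambda> \<and> src \<Lambda> a \<in> objs \<Lambda>) \<and>
     (\<forall>v\<in>objs \<Lambda>. rng \<Lambda> v = v \<and> src \<Lambda> v = v) \<and>
     (\<forall>(a, b)\<in>composable \<Lambda>. cmp \<Lambda> a b \<in> mors \<Lambda> \<and>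
        rng \<Lambda> (cmp \<Lambda> a b) = rng \<Lambda> a \<and> src \<Lambda> (cmp \<Lambda> a b) = src \<Lambda> b) \<and>
     (\<forall>a\<in>mors \<Lambda>. cmp \<Lambda> (rng \<Lambda> a) a = a \<and> cmp \<Lambda> a (src \<Lambda> a) = a) \<and>
     (\<forall>a b c. (a, b) \<in> composable \<Lambda> \<longrightarrow> (b, c) \<in> composable \<Lambda> \<longrightarrow>
        cmp \<Lambda> (cmp \<Lambda> a b) c = cmp \<Lambda> a (cmp \<Lambda> b c))"

definition degree_functor :: "nat \<Rightarrow> 'a kgraph \<Rightarrow> bool" where
  "degree_functor k \<Lambda> \<longleftrightarrow>
     (\<forall>a\<in>mors \<Lambda>. deg \<Lambda> a \<in> degs k) \<and>
     (\<forall>v\<in>objs \<Lambda>. deg \<Lambda> v = 0) \<and>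
     (\<forall>(a, b)\<in>composable \<Lambda>. deg \<Lambda> (cmp \<Lambda> a b) = deg \<Lambda> a + deg \<Lambda> b)"

definition local_homeomorphism :: "'a topology \<Rightarrow> 'b topology \<Rightarrow> ('a \<Rightarrow> 'b) \<Rightarrow> bool" where
  "local_homeomorphism X Y f \<longleftrightarrow>
     (\<forall>x\<in>topspace X. \<exists>U. openin X U \<and> x \<in> U \<and> openin Y (f ` U) \<and>
        homeomorphic_map (subtopology X U) (subtopology Y (f ` U)) f)"

locale topological_kgraph =
  fixes k :: nat and \<Lambda> :: "'a kgraph"
  assumes category: "small_category \<Lambda>"
    and degree: "degree_functor k \<Lambda>"
    and obj_space: "second_countable (Obj \<Lambda>)" "locally_compact_space (Obj \<Lambda>)" "Hausdorff_space (Obj \<Lambda>)"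
    and mor_space: "second_countable (Mor \<Lambda>)" "locally_compact_space (Mor \<Lambda>)" "Hausdorff_space (Mor \<Lambda>)"
    and rng_continuous: "continuous_map (Mor \<Lambda>) (Obj \<Lambda>) (rng \<Lambda>)"
    and src_continuous: "continuous_map (Mor \<Lambda>) (Obj \<Lambda>) (src \<Lambda>)"
    and src_local_homeo: "local_homeomorphism (Mor \<Lambda>) (Obj \<Lambda>) (src \<Lambda>)"
    and cmp_continuous: "continuous_map (subtopology (prod_topology (Mor \<Lambda>) (Mor \<Lambda>)) (composable \<Lambda>))
                           (Mor \<Lambda>) (\<lambda>(a, b). cmp \<Lambda> a b)"
    and cmp_open: "open_map (subtopology (prod_topology (Mor \<Lambda>) (Mor \<Lambda>)) (composable \<Lambda>))
                     (Mor \<Lambda>) (\<lambda>(a, b). cmp \<Lambda> a b)"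
    and deg_continuous: "continuous_map (Mor \<Lambda>) (discrete_topology (degs k)) (deg \<Lambda>)"
    and factorization: "\<And>a m n. a \<in> mors \<Lambda> \<Longrightarrow> m \<in> degs k \<Longrightarrow> n \<in> degs k \<Longrightarrow> deg \<Lambda> a = m + n \<Longrightarrow>
        \<exists>!(b, c). (b, c) \<in> composable \<Lambda> \<and> a = cmp \<Lambda> b c \<and> deg \<Lambda> b = m \<and> deg \<Lambda> c = n"

definition level :: "'a kgraph \<Rightarrow> (nat \<Rightarrow> nat) \<Rightarrow> 'a set" where
  "level \<Lambda> m = {a \<in> mors \<Lambda>. deg \<Lambda> a = m}"

definition set_cmp :: "'a kgraph \<Rightarrow> 'a set \<Rightarrow> 'a set \<Rightarrow> 'a set" where
  "set_cmp \<Lambda> U V = {cmp \<Lambda> a b |a b. a \<in> U \<and> b \<in> V \<and> (a, b) \<in> composable \<Lambda>}"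

definition proper_kgraph :: "nat \<Rightarrow> 'a kgraph \<Rightarrow> bool" where
  "proper_kgraph k \<Lambda> \<longleftrightarrow>
     (\<forall>m\<in>degs k. \<forall>U. compactin (Obj \<Lambda>) U \<longrightarrow> compactin (Mor \<Lambda>) (set_cmp \<Lambda> U (level \<Lambda> m)))"

definition is_source :: "nat \<Rightarrow> 'a kgraph \<Rightarrow> 'a \<Rightarrow> bool" where
  "is_source k \<Lambda> v \<longleftrightarrow> v \<in> objs \<Lambda> \<and> (\<exists>i<k. set_cmp \<Lambda> {v} (level \<Lambda> (unit_deg i)) = {})"

section \<open>Path space\<close>

text \<open>The object \<open>p\<close> is identified with the identity \<open>(p, p)\<close>.\<close>

definition Omega :: "nat \<Rightarrow> (nat \<Rightarrow> enat) \<Rightarrow> ((nat \<Rightarrow> nat) \<times> (nat \<Rightarrow> nat)) kgraph" where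
  "Omega k m =
     \<lparr> Obj = discrete_topology {(p, p) |p. p \<in> degs k \<and> xdeg p \<le> m},
       Mor = discrete_topology {(p, q). p \<in> degs k \<and> q \<in> degs k \<and> p \<le> q \<and> xdeg q \<le> m},
       rng = (\<lambda>(p, q). (p, p)),
       src = (\<lambda>(p, q). (q, q)),
       cmp = (\<lambda>(n, p) (p', q). (n, q)),
       deg = (\<lambda>(p, q). q - p) \<rparr>"

definition kgraph_functor :: "'b kgraph \<Rightarrow> 'a kgraph \<Rightarrow> ('b \<Rightarrow> 'a) \<Rightarrow> bool" where
  "kgraph_functor \<Gamma> \<Lambda> f \<longleftrightarrow>
     continuous_map (Obj \<Gamma>) (Obj \<Lambda>) f \<and> continuous_map (Mor \<Gamma>) (Mor \<Lambda>) f \<and>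
     (\<forall>a\<in>mors \<Gamma>. f (rng \<Gamma> a) = rng \<Lambda> (f a) \<and> f (src \<Gamma> a) = src \<Lambda> (f a)) \<and>
     (\<forall>(a, b)\<in>composable \<Gamma>. f (cmp \<Gamma> a b) = cmp \<Lambda> (f a) (f b)) \<and>
     (\<forall>a\<in>mors \<Gamma>. deg \<Lambda> (f a) = deg \<Gamma> a)"

text \<open>
  A path is stored with its degree. The functor is \<open>undefined\<close> outside its domain, so that
  equality of paths is HOL equality.
\<close>

type_synonym 'a kpath = "(nat \<Rightarrow> enat) \<times> ((nat \<Rightarrow> nat) \<times> (nat \<Rightarrow> nat) \<Rightarrow> 'a)"

definition path_space :: "nat \<Rightarrow> 'a kgraph \<Rightarrow> 'a kpath set" where
  "path_space k \<Lambda> = {(m, x). m \<in> degs k \<and> kgraph_functor (Omega k m) \<Lambda> x \<and>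
                              x \<in> extensional (mors (Omega k m))}"

definition pdeg :: "'a kpath \<Rightarrow> nat \<Rightarrow> enat" where
  "pdeg x = fst x"

definition seg :: "'a kpath \<Rightarrow> (nat \<Rightarrow> nat) \<Rightarrow> (nat \<Rightarrow> nat) \<Rightarrow> 'a" where
  "seg x p q = snd x (p, q)"

definition prng :: "'a kpath \<Rightarrow> 'a" where
  "prng x = seg x 0 0"

definition shift :: "nat \<Rightarrow> (nat \<Rightarrow> nat) \<Rightarrow> 'a kpath \<Rightarrow> 'a kpath" where
  "shift k m x = (pdeg x - xdeg m,
     restrict (\<lambda>(p, q). seg x (m + p) (m + q)) (mors (Omega k (pdeg x - xdeg m))))"

definition prepend :: "nat \<Rightarrow> 'a kgraph \<Rightarrow> 'a \<Rightarrow> 'a kpath \<Rightarrow> 'a kpath" where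
  "prepend k \<Lambda> a x = (THE y. y \<in> path_space k \<Lambda> \<and> pdeg y = xdeg (deg \<Lambda> a) + pdeg x \<and>
                              seg y 0 (deg \<Lambda> a) = a \<and> shift k (deg \<Lambda> a) y = x)"

section \<open>Topological groupoids and amenability\<close>

text \<open>Units are identified with elements of the groupoid, so \<open>grng\<close> and \<open>gsrc\<close> return units.\<close>

record 'g top_groupoid =
  gtop :: "'g topology"
  grng :: "'g \<Rightarrow> 'g"
  gsrc :: "'g \<Rightarrow> 'g"
  gmult :: "'g \<Rightarrow> 'g \<Rightarrow> 'g"
  ginv :: "'g \<Rightarrow> 'g"

definition gunits :: "'g top_groupoid \<Rightarrow> 'g set" where
  "gunits \<Gamma> = grng \<Gamma> ` topspace (gtop \<Gamma>)"

definition gfibre :: "'g top_groupoid \<Rightarrow> 'g \<Rightarrow> 'g set" where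
  "gfibre \<Gamma> x = {g \<in> topspace (gtop \<Gamma>). grng \<Gamma> g = x}"

definition reduction :: "'g top_groupoid \<Rightarrow> 'g set \<Rightarrow> 'g top_groupoid" where
  "reduction \<Gamma> Y = \<Gamma>\<lparr> gtop := subtopology (gtop \<Gamma>) {g. grng \<Gamma> g \<in> Y \<and> gsrc \<Gamma> g \<in> Y} \<rparr>"

definition Borel_of :: "'g topology \<Rightarrow> 'g measure" where
  "Borel_of T = sigma (topspace T) {U. openin T U}"

definition Cc :: "'g topology \<Rightarrow> ('g \<Rightarrow> complex) set" where
  "Cc T = {f. continuous_map T euclidean f \<and> compactin T (T closure_of {g \<in> topspace T. f g \<noteq> 0})}"

text \<open>The measure \<open>g M\<close>: push-forward of \<open>M\<close>, carried by $r^{-1}(s(g))$, under \<open>h \<mapsto> g h\<close>.\<close>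

definition translate :: "'g top_groupoid \<Rightarrow> 'g \<Rightarrow> 'g measure \<Rightarrow> 'g measure" where
  "translate \<Gamma> g M =
     distr (restrict_space M (gfibre \<Gamma> (gsrc \<Gamma> g))) (Borel_of (gtop \<Gamma>)) (gmult \<Gamma> g)"

text \<open>Total variation norm of \<open>M - N\<close>, for finite measures \<open>M\<close>, \<open>N\<close> on the same sigma-algebra.\<close>

definition tv_dist :: "'g measure \<Rightarrow> 'g measure \<Rightarrow> real" where
  "tv_dist M N = (SUP P\<in>{P. finite P \<and> P \<subseteq> sets M \<and> disjoint P}.
                    \<Sum>A\<in>P. \<bar>measure M A - measure N A\<bar>)"

definition continuous_prob_system :: "'g top_groupoid \<Rightarrow> ('g \<Rightarrow> 'g measure) \<Rightarrow> bool" where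
  "continuous_prob_system \<Gamma> m \<longleftrightarrow>
     (\<forall>x\<in>gunits \<Gamma>. prob_space (m x) \<and> sets (m x) = sets (Borel_of (gtop \<Gamma>)) \<and>
                    (AE g in m x. g \<in> gfibre \<Gamma> x)) \<and>
     (\<forall>f\<in>Cc (gtop \<Gamma>).
        continuous_map (subtopology (gtop \<Gamma>) (gunits \<Gamma>)) euclidean (\<lambda>x. integral\<^sup>L (m x) f))"

definition directed_set :: "'i set \<Rightarrow> ('i \<Rightarrow> 'i \<Rightarrow> bool) \<Rightarrow> bool" where
  "directed_set I le \<longleftrightarrow> I \<noteq> {} \<and> (\<forall>i\<in>I. le i i) \<and>
     (\<forall>i\<in>I. \<forall>j\<in>I. \<forall>l\<in>I. le i j \<longrightarrow> le j l \<longrightarrow> le i l) \<and>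
     (\<forall>i\<in>I. \<forall>j\<in>I. \<exists>l\<in>I. le i l \<and> le j l)"

text \<open>
  Topological amenability; meant for \<open>\<Gamma>\<close> a locally compact groupoid. HOL cannot quantify over the type of
  the index set of a net; the type \<open>'g set \<times> real\<close> is no restriction, because a net with any
  directed index set can be replaced by one indexed by pairs of a compact set and a positive
  tolerance, ordered by \<open>\<subseteq>\<close> and \<open>\<ge>\<close>.
\<close>

definition amenable_groupoid :: "'g top_groupoid \<Rightarrow> bool" where
  "amenable_groupoid \<Gamma> \<longleftrightarrow>
     (\<exists>(I :: ('g set \<times> real) set) le (m :: ('g set \<times> real) \<Rightarrow> 'g \<Rightarrow> 'g measure).
        directed_set I le \<and>
        (\<forall>i\<in>I. continuous_prob_system \<Gamma> (m i)) \<and>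
        (\<forall>K. compactin (gtop \<Gamma>) K \<longrightarrow>
           (\<forall>\<epsilon>>0. \<exists>i0\<in>I. \<forall>i\<in>I. le i0 i \<longrightarrow>
              (\<forall>g\<in>K. tv_dist (translate \<Gamma> g (m i (gsrc \<Gamma> g))) (m i (grng \<Gamma> g)) < \<epsilon>))))"

section \<open>The path groupoid\<close>

type_synonym 'a path_arrow = "'a kpath \<times> (nat \<Rightarrow> int) \<times> 'a kpath"

definition src_pairs :: "'a kgraph \<Rightarrow> ('a \<times> 'a) set" where
  "src_pairs \<Lambda> = {(a, b). a \<in> mors \<Lambda> \<and> b \<in> mors \<Lambda> \<and> src \<Lambda> a = src \<Lambda> b}"

definition deg_diff :: "'a kgraph \<Rightarrow> 'a \<Rightarrow> 'a \<Rightarrow> nat \<Rightarrow> int" where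
  "deg_diff \<Lambda> a b = (\<lambda>i. int (deg \<Lambda> a i) - int (deg \<Lambda> b i))"

definition path_arrows :: "nat \<Rightarrow> 'a kgraph \<Rightarrow> 'a path_arrow set" where
  "path_arrows k \<Lambda> = {(prepend k \<Lambda> a x, deg_diff \<Lambda> a b, prepend k \<Lambda> b x) |a b x.
     (a, b) \<in> src_pairs \<Lambda> \<and> x \<in> path_space k \<Lambda> \<and> prng x = src \<Lambda> a}"

definition Zset :: "nat \<Rightarrow> 'a kgraph \<Rightarrow> ('a \<times> 'a) set \<Rightarrow> (nat \<Rightarrow> int) \<Rightarrow> 'a path_arrow set" where
  "Zset k \<Lambda> F m = {(prepend k \<Lambda> a x, deg_diff \<Lambda> a b, prepend k \<Lambda> b x) |a b x.
     (a, b) \<in> F \<and> (a, b) \<in> src_pairs \<Lambda> \<and> x \<in> path_space k \<Lambda> \<and> prng x = src \<Lambda> a \<and>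
     deg_diff \<Lambda> a b = m}"

text \<open>
  For compactly aligned \<open>\<Lambda>\<close> these sets form a basis, so the topology they generate below is the
  one with this basis.
\<close>

definition path_groupoid_basis :: "nat \<Rightarrow> 'a kgraph \<Rightarrow> 'a path_arrow set set" where
  "path_groupoid_basis k \<Lambda> =
     {Zset k \<Lambda> ((U \<times> V) \<inter> src_pairs \<Lambda>) m \<inter> (path_arrows k \<Lambda> - Zset k \<Lambda> F m) |U V F m.
        m \<in> degs k \<and> openin (Mor \<Lambda>) U \<and> openin (Mor \<Lambda>) V \<and>
        F \<subseteq> src_pairs \<Lambda> \<and> compactin (prod_topology (Mor \<Lambda>) (Mor \<Lambda>)) F}"

definition punit :: "'a kpath \<Rightarrow> 'a path_arrow" where
  "punit x = (x, 0, x)"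

definition path_groupoid :: "nat \<Rightarrow> 'a kgraph \<Rightarrow> 'a path_arrow top_groupoid" where
  "path_groupoid k \<Lambda> =
     \<lparr> gtop = topology_generated_by (path_groupoid_basis k \<Lambda>),
       grng = (\<lambda>(x, m, y). punit x),
       gsrc = (\<lambda>(x, m, y). punit y),
       gmult = (\<lambda>(x, m, y) (y', n, z). (x, m + n, z)),
       ginv = (\<lambda>(x, m, y). (y, - m, x)) \<rparr>"

section \<open>Boundary paths\<close>

definition min_ext :: "'a kgraph \<Rightarrow> 'a \<Rightarrow> 'a \<Rightarrow> ('a \<times> 'a) set" where
  "min_ext \<Lambda> l \<mu> = {(a, b). (l, a) \<in> composable \<Lambda> \<and> (\<mu>, b) \<in> composable \<Lambda> \<and>
     cmp \<Lambda> l a = cmp \<Lambda> \<mu> b \<and> deg \<Lambda> (cmp \<Lambda> l a) = sup (deg \<Lambda> l) (deg \<Lambda> \<mu>)}"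

definition exhaustive :: "'a kgraph \<Rightarrow> 'a set \<Rightarrow> 'a set \<Rightarrow> bool" where
  "exhaustive \<Lambda> V E \<longleftrightarrow> E \<subseteq> set_cmp \<Lambda> V (mors \<Lambda>) \<and>
     (\<forall>l\<in>set_cmp \<Lambda> V (mors \<Lambda>). \<exists>\<mu>\<in>E. min_ext \<Lambda> l \<mu> \<noteq> {})"

definition compact_exhaustive :: "'a kgraph \<Rightarrow> 'a \<Rightarrow> 'a set set" where
  "compact_exhaustive \<Lambda> v = {E. compactin (Mor \<Lambda>) E \<and>
     (\<exists>W. openin (Obj \<Lambda>) W \<and> v \<in> W \<and> W \<subseteq> rng \<Lambda> ` E) \<and> exhaustive \<Lambda> (rng \<Lambda> ` E) E}"

text \<open>
  The condition \<open>xdeg (m + deg \<Lambda> l) \<le> pdeg x\<close> says that $x(m, m+d(\lambda))$ is defined.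
\<close>

definition boundary_paths :: "nat \<Rightarrow> 'a kgraph \<Rightarrow> 'a kpath set" where
  "boundary_paths k \<Lambda> = {x \<in> path_space k \<Lambda>.
     \<forall>m\<in>degs k. xdeg m \<le> pdeg x \<longrightarrow>
       (\<forall>E\<in>compact_exhaustive \<Lambda> (seg x m m).
          \<exists>l\<in>E. xdeg (m + deg \<Lambda> l) \<le> pdeg x \<and> seg x m (m + deg \<Lambda> l) = l)}"

definition boundary_path_groupoid :: "nat \<Rightarrow> 'a kgraph \<Rightarrow> 'a path_arrow top_groupoid" where
  "boundary_path_groupoid k \<Lambda> = reduction (path_groupoid k \<Lambda>) (punit ` boundary_paths k \<Lambda>)"

end

(*
Since Lambda is proper and has no sources, the set K Lambda^(e_i), for K a compact neighbourhood of
x(m), is compact and exhaustive for K; hence a boundary path has infinite degree in each of the k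
directions, and sigma^n acts on all boundary paths x for every n in N^k. Let m_N^x be the uniform
distribution on the arrows (x, n, sigma^n x) with n in the box [0, N)^k. It depends continuously on
x because x |-> (x, n, sigma^n x) is continuous. If sigma^p x = sigma^q y, then left translation by
(x, p - q, y) maps (y, n, sigma^n y) to (x, n - q + p, sigma^(n - q + p) x) for n >= q, so it
changes m_N only near the boundary of the box; p and q are bounded on compact sets of arrows, and
the boxes form a Folner sequence.
*)

theory Submission
  imports Defs "HOL-Probability.Product_PMF"
begin

text \<open>Infinite degree reduces everything to segments: an arrow between boundary paths is a
  triple (x, m, y) for which some p, q satisfy m = p - q and have the shift of x by p equal to the
  shift of y by q, and membership in Z(F, m) becomes a condition on the pairs x(0, p), y(0, q). Such
  p, q may always be increased together, so Z(F, m) is a union over infinitely many degrees. This is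
  the obstacle to continuity of the shift arrows: basic sets remove some Z(F, m), and its preimage
  is closed only because a compact F meets finitely many degrees. The measures live on the Borel
  sets of the whole groupoid and a translate is a push-forward from one fibre, so measurability is
  needed as well: range fibres are closed because initial segments determine a path, and discrete
  because the source map is locally injective. The invariance estimate compares only indices in [M,
  N - M)^k, where M bounds p and q. There n - q is a true difference and n - q + p stays in the box;
  the discarded fraction is 1 - (1 - 2M/N)^k, and it counts once for each of the two
  measures.\<close>

section \<open>Degrees\<close>

lemma zero_degs [simp]: "0 \<in> degs k"
  by (simp add: degs_def)

lemma degs_add [simp]: "m \<in> degs k \<Longrightarrow> n \<in> degs k \<Longrightarrow> m + n \<in> degs k"
  for m n :: "nat \<Rightarrow> nat"
  by (simp add: degs_def)

lemma degs_diff [simp]: "m \<in> degs k \<Longrightarrow> m - n \<in> degs k"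
  for m n :: "nat \<Rightarrow> nat"
  by (simp add: degs_def)

lemma degs_mono: "n \<in> degs k \<Longrightarrow> m \<le> n \<Longrightarrow> m \<in> degs k"
  for m n :: "nat \<Rightarrow> nat"
  by (auto simp: degs_def le_fun_def) (metis le_zero_eq)

lemma unit_deg_degs [simp]: "i < k \<Longrightarrow> unit_deg i \<in> degs k"
  by (simp add: degs_def unit_deg_def)

lemma deg_add_diff: "m \<le> n \<Longrightarrow> m + (n - m) = n"
  for m n :: "nat \<Rightarrow> nat"
  by (auto simp: le_fun_def)

text \<open>Subtraction on \<open>enat\<close> truncates, so \<open>m\<close> must lie below
  \<open>d\<close>: if a coordinate of \<open>m\<close> exceeded that of \<open>d\<close>, the left
  side would hold for \<open>q = 0\<close> and the right side would fail. Infinite coordinates of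
  \<open>d\<close> are unchanged by the subtraction.\<close>

lemma xdeg_le_diff_iff:
  assumes "xdeg m \<le> d"
  shows "xdeg q \<le> d - xdeg m \<longleftrightarrow> xdeg (m + q) \<le> d"
proof -
  have "enat (q i) \<le> d i - enat (m i) \<longleftrightarrow> enat (m i + q i) \<le> d i" for i
    using le_funD[OF assms, of i] by (cases "d i") auto
  then show ?thesis
    by (simp add: le_fun_def)
qed

lemma xdeg_diff_le:
  assumes "xdeg q \<le> xdeg a + d"
  shows "xdeg (q - a) \<le> d"
proof (rule le_funI)
  fix i
  have "enat (q i) \<le> enat (a i) + d i"
    using assms by (simp add: le_fun_def)
  then show "xdeg (q - a) i \<le> d i"
    by (cases "d i") auto
qed

lemma xdeg_add_diff [simp]: "xdeg a + d - xdeg a = d"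
  by (rule ext) simp

lemma xdeg_le_add: "xdeg n \<le> d \<Longrightarrow> xdeg (m + n) \<le> xdeg m + d"
  by (simp add: le_fun_def flip: plus_enat_simps)

lemma xdeg_le_add_left: "xdeg m \<le> xdeg m + d"
  by (simp add: le_fun_def)

lemma xdeg_mono: "xdeg q \<le> d \<Longrightarrow> p \<le> q \<Longrightarrow> xdeg p \<le> d"
  by (rule order.trans[of _ "xdeg q"]) (simp_all add: le_fun_def)

lemma le_add_deg_diff: "q \<le> m + (q - m)" for m q :: "nat \<Rightarrow> nat"
  by (rule le_funI) simp

lemma deg_diff_mono: "p \<le> q \<Longrightarrow> p - m \<le> q - m" for m p q :: "nat \<Rightarrow> nat"
  by (simp add: le_fun_def diff_le_mono)

lemma zero_le_deg [simp]: "0 \<le> m" for m :: "nat \<Rightarrow> nat"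
  by (simp add: le_fun_def)

lemma le_add_deg [simp]: "m \<le> m + n" for m n :: "nat \<Rightarrow> nat"
  by (simp add: le_fun_def)

definition deg_int :: "(nat \<Rightarrow> nat) \<Rightarrow> nat \<Rightarrow> int" where
  "deg_int n = (\<lambda>i. int (n i))"

section \<open>Unique factorization\<close>

context topological_kgraph
begin

lemma objs_mors [simp]: "v \<in> objs \<Lambda> \<Longrightarrow> v \<in> mors \<Lambda>"
  using category by (auto simp: small_category_def)

lemma rng_objs [simp]: "a \<in> mors \<Lambda> \<Longrightarrow> rng \<Lambda> a \<in> objs \<Lambda>"
  using category by (auto simp: small_category_def)

lemma src_objs [simp]: "a \<in> mors \<Lambda> \<Longrightarrow> src \<Lambda> a \<in> objs \<Lambda>"
  using category by (auto simp: small_category_def)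

lemma rng_obj [simp]: "v \<in> objs \<Lambda> \<Longrightarrow> rng \<Lambda> v = v"
  using category by (auto simp: small_category_def)

lemma src_obj [simp]: "v \<in> objs \<Lambda> \<Longrightarrow> src \<Lambda> v = v"
  using category by (auto simp: small_category_def)

lemma deg_obj [simp]: "v \<in> objs \<Lambda> \<Longrightarrow> deg \<Lambda> v = 0"
  using degree by (auto simp: degree_functor_def)

lemma deg_degs [simp]: "a \<in> mors \<Lambda> \<Longrightarrow> deg \<Lambda> a \<in> degs k"
  using degree by (auto simp: degree_functor_def)

lemma composable_iff:
  "(a, b) \<in> composable \<Lambda> \<longleftrightarrow> a \<in> mors \<Lambda> \<and> b \<in> mors \<Lambda> \<and> src \<Lambda> a = rng \<Lambda> b"
  by (simp add: composable_def)

lemma cmp_closed: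
  assumes "(a, b) \<in> composable \<Lambda>"
  shows "cmp \<Lambda> a b \<in> mors \<Lambda>" "rng \<Lambda> (cmp \<Lambda> a b) = rng \<Lambda> a" "src \<Lambda> (cmp \<Lambda> a b) = src \<Lambda> b"
    "deg \<Lambda> (cmp \<Lambda> a b) = deg \<Lambda> a + deg \<Lambda> b"
  using assms category degree by (auto simp: small_category_def degree_functor_def)

lemma cmp_rng [simp]: "a \<in> mors \<Lambda> \<Longrightarrow> cmp \<Lambda> (rng \<Lambda> a) a = a"
  using category by (auto simp: small_category_def)

lemma cmp_src [simp]: "a \<in> mors \<Lambda> \<Longrightarrow> cmp \<Lambda> a (src \<Lambda> a) = a"
  using category by (auto simp: small_category_def)

lemma cmp_assoc:
  "(a, b) \<in> composable \<Lambda> \<Longrightarrow> (b, c) \<in> composable \<Lambda> \<Longrightarrow>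
   cmp \<Lambda> (cmp \<Lambda> a b) c = cmp \<Lambda> a (cmp \<Lambda> b c)"
  using category unfolding small_category_def by blast

lemma composable_assoc:
  assumes "(a, b) \<in> composable \<Lambda>" "(b, c) \<in> composable \<Lambda>"
  shows "(cmp \<Lambda> a b, c) \<in> composable \<Lambda>" "(a, cmp \<Lambda> b c) \<in> composable \<Lambda>"
  using assms cmp_closed[OF assms(1)] cmp_closed[OF assms(2)] by (auto simp: composable_iff)

lemma cmp_cancel:
  assumes "(a, b) \<in> composable \<Lambda>" "(a', b') \<in> composable \<Lambda>"
    and "cmp \<Lambda> a b = cmp \<Lambda> a' b'" "deg \<Lambda> a = deg \<Lambda> a'"
  shows "a = a'" "b = b'"
proof -
  have "deg \<Lambda> a + deg \<Lambda> b = deg \<Lambda> a' + deg \<Lambda> b'"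
    using assms cmp_closed(4) by metis
  then have "deg \<Lambda> b = deg \<Lambda> b'"
    using assms(4) by simp
  moreover have "\<exists>!(c, e). (c, e) \<in> composable \<Lambda> \<and> cmp \<Lambda> a b = cmp \<Lambda> c e \<and>
      deg \<Lambda> c = deg \<Lambda> a \<and> deg \<Lambda> e = deg \<Lambda> b"
    using assms(1) cmp_closed[OF assms(1)] by (intro factorization) (simp_all add: composable_iff)
  ultimately have "(a, b) = (a', b')"
    using assms by (elim ex1E) (metis (mono_tags, lifting) case_prodI)
  then show "a = a'" "b = b'"
    by auto
qed

text \<open>Both r(a)a and a s(a) are factorizations of \<open>a\<close> with left factor of degree
  0, so uniqueness gives \<open>a\<close> = r(a).\<close>

lemma deg_zero_objs:
  assumes "a \<in> mors \<Lambda>" "deg \<Lambda> a = 0"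
  shows "a \<in> objs \<Lambda>"
proof -
  have "rng \<Lambda> a = a"
    using assms by (intro cmp_cancel(1)[of "rng \<Lambda> a" a a "src \<Lambda> a"]) (auto simp: composable_iff)
  then show ?thesis
    using assms(1) rng_objs by metis
qed

text \<open>For m \<le> d(a), \<open>head a m\<close> is the segment usually written a(0, m), and
  \<open>tail a m\<close> is a(m, d(a)).\<close>

definition head :: "'a \<Rightarrow> (nat \<Rightarrow> nat) \<Rightarrow> 'a" where
  "head a m = (THE b. \<exists>c. (b, c) \<in> composable \<Lambda> \<and> a = cmp \<Lambda> b c \<and> deg \<Lambda> b = m)"

definition tail :: "'a \<Rightarrow> (nat \<Rightarrow> nat) \<Rightarrow> 'a" where
  "tail a m = (THE c. \<exists>b. (b, c) \<in> composable \<Lambda> \<and> a = cmp \<Lambda> b c \<and> deg \<Lambda> b = m)"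

lemma head_cmp: "(b, c) \<in> composable \<Lambda> \<Longrightarrow> deg \<Lambda> b = m \<Longrightarrow> head (cmp \<Lambda> b c) m = b"
  unfolding head_def by (rule the_equality) (auto dest: cmp_cancel(1))

lemma tail_cmp: "(b, c) \<in> composable \<Lambda> \<Longrightarrow> deg \<Lambda> b = m \<Longrightarrow> tail (cmp \<Lambda> b c) m = c"
  unfolding tail_def by (rule the_equality) (auto dest: cmp_cancel(2))

lemma factor_exists:
  assumes "a \<in> mors \<Lambda>" "m \<le> deg \<Lambda> a"
  obtains b c where "(b, c) \<in> composable \<Lambda>" "a = cmp \<Lambda> b c" "deg \<Lambda> b = m" "deg \<Lambda> c = deg \<Lambda> a - m"
proof -
  have "m \<in> degs k"
    using assms degs_mono deg_degs by blast
  then have "\<exists>!(b, c). (b, c) \<in> composable \<Lambda> \<and> a = cmp \<Lambda> b c \<and> deg \<Lambda> b = m \<and> deg \<Lambda> c = deg \<Lambda> a - m"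
    using assms by (intro factorization) (auto simp: deg_add_diff)
  then show ?thesis
    using that by auto
qed

lemma head_tail:
  assumes "a \<in> mors \<Lambda>" "m \<le> deg \<Lambda> a"
  shows "(head a m, tail a m) \<in> composable \<Lambda>" "cmp \<Lambda> (head a m) (tail a m) = a"
    "deg \<Lambda> (head a m) = m" "deg \<Lambda> (tail a m) = deg \<Lambda> a - m"
proof -
  obtain b c where bc: "(b, c) \<in> composable \<Lambda>" "a = cmp \<Lambda> b c" "deg \<Lambda> b = m" "deg \<Lambda> c = deg \<Lambda> a - m"
    using factor_exists[OF assms] .
  moreover have "head a m = b" "tail a m = c"
    using bc head_cmp tail_cmp by auto
  ultimately show "(head a m, tail a m) \<in> composable \<Lambda>" "cmp \<Lambda> (head a m) (tail a m) = a"
    "deg \<Lambda> (head a m) = m" "deg \<Lambda> (tail a m) = deg \<Lambda> a - m"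
    by auto
qed

lemma head_mors [simp]: "a \<in> mors \<Lambda> \<Longrightarrow> m \<le> deg \<Lambda> a \<Longrightarrow> head a m \<in> mors \<Lambda>"
  using head_tail(1) composable_iff by blast

lemma tail_mors [simp]: "a \<in> mors \<Lambda> \<Longrightarrow> m \<le> deg \<Lambda> a \<Longrightarrow> tail a m \<in> mors \<Lambda>"
  using head_tail(1) composable_iff by blast

section \<open>Openness of conditions on initial and final segments\<close>

lemma openin_level: "openin (Mor \<Lambda>) {a \<in> mors \<Lambda>. deg \<Lambda> a = m}"
proof (cases "m \<in> degs k")
  case True
  then have "openin (Mor \<Lambda>) {a \<in> mors \<Lambda>. deg \<Lambda> a \<in> {m}}"
    by (intro openin_continuous_map_preimage[OF deg_continuous]) auto
  then show ?thesis by simp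
next
  case False
  then have "{a \<in> mors \<Lambda>. deg \<Lambda> a = m} = {}"
    using deg_degs by auto
  then show ?thesis by (simp only: openin_empty)
qed

lemma openin_cmp_image:
  assumes "openin (Mor \<Lambda>) U" "openin (Mor \<Lambda>) V"
  shows "openin (Mor \<Lambda>) ((\<lambda>(a, b). cmp \<Lambda> a b) ` (composable \<Lambda> \<inter> U \<times> V))"
proof -
  have "openin (subtopology (prod_topology (Mor \<Lambda>) (Mor \<Lambda>)) (composable \<Lambda>)) (composable \<Lambda> \<inter> U \<times> V)"
    using assms by (intro openin_subtopology_Int2) (auto simp: openin_prod_Times_iff)
  then show ?thesis
    using cmp_open by (simp add: open_map_def)
qed

text \<open>This is where openness of composition enters: the set is the product of the open set of
  degree-\<open>m\<close> elements of \<open>U\<close> with the whole morphism space. It expresses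
  continuity of taking initial segments.\<close>

lemma openin_head_preimage:
  assumes "openin (Mor \<Lambda>) U"
  shows "openin (Mor \<Lambda>) {a \<in> mors \<Lambda>. m \<le> deg \<Lambda> a \<and> head a m \<in> U}"
proof -
  have "{a \<in> mors \<Lambda>. m \<le> deg \<Lambda> a \<and> head a m \<in> U} =
        (\<lambda>(a, b). cmp \<Lambda> a b) ` (composable \<Lambda> \<inter> (U \<inter> {a \<in> mors \<Lambda>. deg \<Lambda> a = m}) \<times> mors \<Lambda>)"
    (is "?L = ?R")
  proof
    show "?L \<subseteq> ?R"
    proof
      fix a assume "a \<in> ?L"
      then show "a \<in> ?R"
        by (intro image_eqI[where x = "(head a m, tail a m)"]) (auto simp: head_tail)
    qed
    show "?R \<subseteq> ?L"
      by (auto simp: cmp_closed head_cmp le_fun_def)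
  qed
  then show ?thesis
    using openin_cmp_image[OF openin_Int[OF assms openin_level[of m]], of "mors \<Lambda>"] by simp
qed

lemma openin_tail_preimage:
  assumes "openin (Mor \<Lambda>) U"
  shows "openin (Mor \<Lambda>) {a \<in> mors \<Lambda>. m \<le> deg \<Lambda> a \<and> tail a m \<in> U}"
proof -
  have "{a \<in> mors \<Lambda>. m \<le> deg \<Lambda> a \<and> tail a m \<in> U} =
        (\<lambda>(a, b). cmp \<Lambda> a b) ` (composable \<Lambda> \<inter> {a \<in> mors \<Lambda>. deg \<Lambda> a = m} \<times> U)"
    (is "?L = ?R")
  proof
    show "?L \<subseteq> ?R"
    proof
      fix a assume "a \<in> ?L"
      then show "a \<in> ?R"
        by (intro image_eqI[where x = "(head a m, tail a m)"]) (auto simp: head_tail)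
    qed
    show "?R \<subseteq> ?L"
      by (auto simp: cmp_closed tail_cmp le_fun_def)
  qed
  then show ?thesis
    using openin_cmp_image[OF openin_level[of m] assms] by simp
qed

text \<open>Splitting the initial segment once more and reassociating exhibits a factorization of
  \<open>a\<close> whose left factor has degree \<open>p\<close>; by uniqueness that factor is
  \<open>head a p\<close>.\<close>

lemma head_head:
  assumes "a \<in> mors \<Lambda>" "p \<le> q" "q \<le> deg \<Lambda> a"
  shows "head (head a q) p = head a p"
proof -
  let ?b = "head a q"
  have b: "?b \<in> mors \<Lambda>" "deg \<Lambda> ?b = q" "(?b, tail a q) \<in> composable \<Lambda>" "cmp \<Lambda> ?b (tail a q) = a"
    using assms by (auto simp: head_tail)
  let ?c = "head ?b p" and ?d = "tail ?b p"
  have c: "(?c, ?d) \<in> composable \<Lambda>" "cmp \<Lambda> ?c ?d = ?b" "deg \<Lambda> ?c = p"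
    using head_tail[of ?b p] b assms by auto
  have d: "(?d, tail a q) \<in> composable \<Lambda>"
    using b c cmp_closed[OF c(1)] by (auto simp: composable_iff)
  have "a = cmp \<Lambda> ?c (cmp \<Lambda> ?d (tail a q))"
    using cmp_assoc[OF c(1) d] b c by simp
  then show ?thesis
    using head_cmp[OF composable_assoc(2)[OF c(1) d] c(3)] by simp
qed

lemma head_cmp_le:
  assumes "(b, c) \<in> composable \<Lambda>" "p \<le> deg \<Lambda> b"
  shows "head (cmp \<Lambda> b c) p = head b p"
  using head_head[of "cmp \<Lambda> b c" p "deg \<Lambda> b"] assms cmp_closed[OF assms(1)] head_cmp[OF assms(1) refl]
  by (simp add: le_fun_def)

lemma head_deg: "a \<in> mors \<Lambda> \<Longrightarrow> head a (deg \<Lambda> a) = a"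
  using head_cmp[of a "src \<Lambda> a"] by (simp add: composable_iff)

text \<open>The segment a(p, q), for p \<le> q \<le> d(a).\<close>

definition middle :: "'a \<Rightarrow> (nat \<Rightarrow> nat) \<Rightarrow> (nat \<Rightarrow> nat) \<Rightarrow> 'a" where
  "middle a p q = tail (head a q) p"

lemma middle:
  assumes "a \<in> mors \<Lambda>" "p \<le> q" "q \<le> deg \<Lambda> a"
  shows "middle a p q \<in> mors \<Lambda>" "deg \<Lambda> (middle a p q) = q - p"
    "(head a p, middle a p q) \<in> composable \<Lambda>" "cmp \<Lambda> (head a p) (middle a p q) = head a q"
    "rng \<Lambda> (middle a p q) = src \<Lambda> (head a p)" "src \<Lambda> (middle a p q) = src \<Lambda> (head a q)"
proof -
  have b: "head a q \<in> mors \<Lambda>" "p \<le> deg \<Lambda> (head a q)"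
    using assms by (auto simp: head_tail)
  note ht = head_tail[OF b, unfolded head_head[OF assms], folded middle_def]
  show 1: "middle a p q \<in> mors \<Lambda>" "deg \<Lambda> (middle a p q) = q - p"
    "(head a p, middle a p q) \<in> composable \<Lambda>" "cmp \<Lambda> (head a p) (middle a p q) = head a q"
    using ht assms by (auto simp: head_tail composable_iff)
  show "rng \<Lambda> (middle a p q) = src \<Lambda> (head a p)"
    using 1 by (simp add: composable_iff)
  show "src \<Lambda> (middle a p q) = src \<Lambda> (head a q)"
    using cmp_closed(3)[OF 1(3)] 1(4) by simp
qed

lemma middle_refl: "a \<in> mors \<Lambda> \<Longrightarrow> p \<le> deg \<Lambda> a \<Longrightarrow> middle a p p = src \<Lambda> (head a p)"
  unfolding middle_def using tail_cmp[of "head a p" "src \<Lambda> (head a p)" p]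
  by (simp add: composable_iff head_tail)

text \<open>After multiplication by a(0, n) on the left both sides become a(0, q), and left factors
  of equal degree cancel.\<close>

lemma middle_cmp:
  assumes "a \<in> mors \<Lambda>" "n \<le> p" "p \<le> q" "q \<le> deg \<Lambda> a"
  shows "cmp \<Lambda> (middle a n p) (middle a p q) = middle a n q"
proof -
  have le: "n \<le> q" "p \<le> deg \<Lambda> a" "n \<le> deg \<Lambda> a"
    using assms by auto
  note np = middle[OF assms(1,2) le(2)] and pq = middle[OF assms(1,3,4)] and nq = middle[OF assms(1) le(1) assms(4)]
  have c: "(middle a n p, middle a p q) \<in> composable \<Lambda>"
    using np pq by (simp add: composable_iff)
  have "cmp \<Lambda> (head a n) (cmp \<Lambda> (middle a n p) (middle a p q)) = head a q"
    using cmp_assoc[OF np(3) c] np pq by simp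
  then show ?thesis
    using cmp_cancel(2)[OF composable_assoc(2)[OF np(3) c] nq(3)] nq by simp
qed

end

section \<open>Shifts and prolongations of paths\<close>

lemma composable_Omega:
  "(a, b) \<in> composable (Omega k m) \<longleftrightarrow>
   (\<exists>n p q. a = (n, p) \<and> b = (p, q) \<and> n \<le> p \<and> p \<le> q \<and> n \<in> degs k \<and> p \<in> degs k \<and> q \<in> degs k \<and> xdeg q \<le> m)"
  using xdeg_mono[of "snd b" m "fst b"] by (cases a; cases b) (auto simp: composable_def Omega_def)

lemma mors_Omega:
  "mors (Omega k m) = {(p, q). p \<in> degs k \<and> q \<in> degs k \<and> p \<le> q \<and> xdeg q \<le> m}"
  by (simp add: Omega_def)

context topological_kgraph
begin

lemma path_pdeg_degs: "x \<in> path_space k \<Lambda> \<Longrightarrow> pdeg x \<in> degs k"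
  by (auto simp: path_space_def pdeg_def)

lemma seg_functor:
  assumes "x \<in> path_space k \<Lambda>" "p \<le> q" "q \<in> degs k" "xdeg q \<le> pdeg x"
  shows "seg x p q \<in> mors \<Lambda>" "deg \<Lambda> (seg x p q) = q - p"
    "rng \<Lambda> (seg x p q) = seg x p p" "src \<Lambda> (seg x p q) = seg x q q"
proof -
  obtain m f where x: "x = (m, f)" by force
  have f: "kgraph_functor (Omega k m) \<Lambda> f"
    using assms(1) x by (simp add: path_space_def)
  have "(p, q) \<in> mors (Omega k m)"
    using assms degs_mono by (auto simp: mors_Omega x pdeg_def)
  then have "f (p, q) \<in> mors \<Lambda> \<and> deg \<Lambda> (f (p, q)) = q - p \<and> rng \<Lambda> (f (p, q)) = f (p, p) \<and> src \<Lambda> (f (p, q)) = f (q, q)"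
    using f unfolding kgraph_functor_def continuous_map_def by (fastforce simp: Omega_def)
  then show "seg x p q \<in> mors \<Lambda>" "deg \<Lambda> (seg x p q) = q - p"
    "rng \<Lambda> (seg x p q) = seg x p p" "src \<Lambda> (seg x p q) = seg x q q"
    by (auto simp: seg_def x)
qed

lemma seg_objs:
  assumes "x \<in> path_space k \<Lambda>" "q \<in> degs k" "xdeg q \<le> pdeg x"
  shows "seg x q q \<in> objs \<Lambda>"
  using seg_functor[OF assms(1) order.refl assms(2,3)] by (intro deg_zero_objs) auto

lemma seg_cmp:
  assumes "x \<in> path_space k \<Lambda>" "n \<le> p" "p \<le> q" "q \<in> degs k" "xdeg q \<le> pdeg x"
  shows "(seg x n p, seg x p q) \<in> composable \<Lambda>" "cmp \<Lambda> (seg x n p) (seg x p q) = seg x n q"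
proof -
  obtain m f where x: "x = (m, f)" by force
  have f: "kgraph_functor (Omega k m) \<Lambda> f"
    using assms(1) x by (simp add: path_space_def)
  have "((n, p), (p, q)) \<in> composable (Omega k m)"
    using assms degs_mono[of q k p] degs_mono[of p k n] by (auto simp: composable_Omega x pdeg_def)
  then have "f (cmp (Omega k m) (n, p) (p, q)) = cmp \<Lambda> (f (n, p)) (f (p, q))"
    using f unfolding kgraph_functor_def by blast
  then show "cmp \<Lambda> (seg x n p) (seg x p q) = seg x n q"
    by (simp add: seg_def x Omega_def)
  have "p \<in> degs k" "xdeg p \<le> pdeg x"
    using assms degs_mono xdeg_mono by blast+
  then show "(seg x n p, seg x p q) \<in> composable \<Lambda>"
    using assms seg_functor by (simp add: composable_iff)
qed

text \<open>Continuity on a discrete space only asks that values lie in the target, and objects are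
  recognized as morphisms of degree 0. What remains of a degree-preserving functor is the two
  conditions on segments.\<close>

lemma path_spaceI:
  assumes "m \<in> degs k" "f \<in> extensional (mors (Omega k m))"
    and "\<And>p q. p \<le> q \<Longrightarrow> q \<in> degs k \<Longrightarrow> xdeg q \<le> m \<Longrightarrow>
      f (p, q) \<in> mors \<Lambda> \<and> deg \<Lambda> (f (p, q)) = q - p \<and> rng \<Lambda> (f (p, q)) = f (p, p) \<and> src \<Lambda> (f (p, q)) = f (q, q)"
    and "\<And>n p q. n \<le> p \<Longrightarrow> p \<le> q \<Longrightarrow> q \<in> degs k \<Longrightarrow> xdeg q \<le> m \<Longrightarrow> f (n, q) = cmp \<Lambda> (f (n, p)) (f (p, q))"
  shows "(m, f) \<in> path_space k \<Lambda>"
proof -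
  have obj: "f (p, p) \<in> objs \<Lambda>" if "p \<in> degs k" "xdeg p \<le> m" for p
    using assms(3)[of p p] that by (intro deg_zero_objs) auto
  have "kgraph_functor (Omega k m) \<Lambda> f"
    unfolding kgraph_functor_def
  proof (intro conjI)
    show "continuous_map (Obj (Omega k m)) (Obj \<Lambda>) f"
      using obj by (auto simp: Omega_def)
    show "continuous_map (Mor (Omega k m)) (Mor \<Lambda>) f"
      using assms(3) by (auto simp: Omega_def)
    show "\<forall>(a, b)\<in>composable (Omega k m). f (cmp (Omega k m) a b) = cmp \<Lambda> (f a) (f b)"
    proof (safe)
      fix a b assume "(a, b) \<in> composable (Omega k m)"
      then obtain n p q where "a = (n, p)" "b = (p, q)" "n \<le> p" "p \<le> q" "q \<in> degs k" "xdeg q \<le> m"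
        by (auto simp: composable_Omega)
      then show "f (cmp (Omega k m) a b) = cmp \<Lambda> (f a) (f b)"
        using assms(4)[of n p q] by (simp add: Omega_def)
    qed
  qed (use assms(3) in \<open>auto simp: Omega_def\<close>)
  then show ?thesis
    using assms(1,2) by (simp add: path_space_def)
qed

lemma seg_head:
  assumes "x \<in> path_space k \<Lambda>" "p \<le> q" "q \<in> degs k" "xdeg q \<le> pdeg x"
  shows "seg x 0 p = head (seg x 0 q) p" "seg x p q = tail (seg x 0 q) p"
proof -
  have "p \<in> degs k" "xdeg p \<le> pdeg x"
    using assms degs_mono xdeg_mono by blast+
  then have "deg \<Lambda> (seg x 0 p) = p"
    using seg_functor(2)[OF assms(1) zero_le_deg, of p] by simp
  moreover note seg_cmp[OF assms(1) zero_le_deg assms(2-4)]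
  ultimately show "seg x 0 p = head (seg x 0 q) p" "seg x p q = tail (seg x 0 q) p"
    using head_cmp tail_cmp by metis+
qed

text \<open>The segment x(p, q) is the tail of x(0, q), so the initial segments carry all
  information; extensionality of the stored function then gives equality in HOL.\<close>

lemma path_eqI:
  assumes x: "x \<in> path_space k \<Lambda>" and y: "y \<in> path_space k \<Lambda>" and deg: "pdeg x = pdeg y"
    and eq: "\<And>q. q \<in> degs k \<Longrightarrow> xdeg q \<le> pdeg x \<Longrightarrow> seg x 0 q = seg y 0 q"
  shows "x = y"
proof -
  have "snd x \<in> extensional (mors (Omega k (pdeg x)))" "snd y \<in> extensional (mors (Omega k (pdeg x)))"
    using x y deg by (auto simp: path_space_def pdeg_def)
  then have "snd x = snd y"
  proof (rule extensionalityI)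
    fix u assume "u \<in> mors (Omega k (pdeg x))"
    then obtain p q where u: "u = (p, q)" "p \<le> q" "q \<in> degs k" "xdeg q \<le> pdeg x"
      by (auto simp: mors_Omega)
    then have "seg x p q = seg y p q"
      using seg_head(2)[OF x u(2-4)] seg_head(2)[OF y u(2-4)[unfolded deg]] eq by simp
    then show "snd x u = snd y u"
      by (simp add: u seg_def)
  qed
  then show ?thesis
    using deg by (simp add: pdeg_def prod_eq_iff)
qed

lemma pdeg_shift [simp]: "pdeg (shift k m x) = pdeg x - xdeg m"
  by (simp add: pdeg_def shift_def)

lemma seg_shift:
  assumes "xdeg m \<le> pdeg x" "p \<le> q" "q \<in> degs k" "xdeg (m + q) \<le> pdeg x"
  shows "seg (shift k m x) p q = seg x (m + p) (m + q)"
  using assms degs_mono[of q k p] xdeg_le_diff_iff[of m "pdeg x" q]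
  by (simp add: shift_def mors_Omega seg_def pdeg_def)

lemma shift_path:
  assumes "x \<in> path_space k \<Lambda>" "m \<in> degs k" "xdeg m \<le> pdeg x"
  shows "shift k m x \<in> path_space k \<Lambda>"
  unfolding shift_def
proof (rule path_spaceI)
  let ?D = "mors (Omega k (pdeg x - xdeg m))"
  let ?f = "restrict (\<lambda>(p, q). seg x (m + p) (m + q)) ?D"
  show "pdeg x - xdeg m \<in> degs k"
    using path_pdeg_degs[OF assms(1)] assms(2) by (simp add: degs_def zero_enat_def)
  have f: "?f (p, q) = seg x (m + p) (m + q)" "xdeg (m + q) \<le> pdeg x" "m + p \<le> m + q" "m + q \<in> degs k"
    if "p \<le> q" "q \<in> degs k" "xdeg q \<le> pdeg x - xdeg m" for p q
    using that assms degs_mono[of q k p] xdeg_le_diff_iff[of m "pdeg x" q] by (auto simp: mors_Omega)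
  fix p q assume pq: "p \<le> q" "q \<in> degs k" "xdeg q \<le> pdeg x - xdeg m"
  then have p: "p \<in> degs k" "xdeg p \<le> pdeg x - xdeg m"
    using degs_mono xdeg_mono by blast+
  show "?f (p, q) \<in> mors \<Lambda> \<and> deg \<Lambda> (?f (p, q)) = q - p \<and> rng \<Lambda> (?f (p, q)) = ?f (p, p) \<and> src \<Lambda> (?f (p, q)) = ?f (q, q)"
    unfolding f(1)[OF pq] f(1)[OF order.refl pq(2,3)] f(1)[OF order.refl p]
    using seg_functor[OF assms(1) f(3,4,2)[OF pq]] by (auto simp: fun_eq_iff)
  fix n assume n: "n \<le> p"
  show "?f (n, q) = cmp \<Lambda> (?f (n, p)) (?f (p, q))"
    unfolding f(1)[OF pq] f(1)[OF n p] f(1)[OF order.trans[OF n pq(1)] pq(2,3)]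
    using seg_cmp(2)[OF assms(1) f(3)[OF n p] f(3,4,2)[OF pq]] by simp
qed auto

lemma shift_shift:
  assumes "x \<in> path_space k \<Lambda>" "m \<in> degs k" "n \<in> degs k" "xdeg (m + n) \<le> pdeg x"
  shows "shift k n (shift k m x) = shift k (m + n) x"
proof -
  have m: "xdeg m \<le> pdeg x"
    using assms(4) by (rule xdeg_mono) simp
  have n: "xdeg n \<le> pdeg x - xdeg m"
    using xdeg_le_diff_iff[OF m] assms(4) by simp
  have d: "pdeg x - xdeg m - xdeg n = pdeg x - xdeg (m + n)"
  proof (rule ext)
    fix i show "(pdeg x - xdeg m - xdeg n) i = (pdeg x - xdeg (m + n)) i"
      by (cases "pdeg x i") auto
  qed
  show ?thesis
  proof (rule path_eqI)
    show "shift k n (shift k m x) \<in> path_space k \<Lambda>" "shift k (m + n) x \<in> path_space k \<Lambda>"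
      using assms m n by (auto intro!: shift_path)
    fix q assume q: "q \<in> degs k" "xdeg q \<le> pdeg (shift k n (shift k m x))"
    then have 1: "xdeg (m + n + q) \<le> pdeg x"
      using xdeg_le_diff_iff[OF assms(4)] d by simp
    have 2: "xdeg (n + q) \<le> pdeg x - xdeg m"
      using xdeg_le_diff_iff[OF m] 1 by (simp add: add.assoc)
    have "seg (shift k n (shift k m x)) 0 q = seg (shift k m x) n (n + q)"
      using seg_shift[of n "shift k m x" 0 q] n q 2 by simp
    also have "\<dots> = seg x (m + n) (m + (n + q))"
      using assms q m 1 by (intro seg_shift) (auto simp: add.assoc)
    also have "\<dots> = seg (shift k (m + n) x) 0 q"
      using seg_shift[OF assms(4), of 0 q] q 1 by (simp add: add.assoc)
    finally show "seg (shift k n (shift k m x)) 0 q = seg (shift k (m + n) x) 0 q" .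
  qed (simp add: d)
qed

text \<open>Any segment of \<open>a x\<close> ending at \<open>q\<close> is read off from the factorization of
  \<open>a x(0, n)\<close> for \<open>n = q - d(a)\<close> (truncated subtraction), and larger \<open>n\<close> give the same result.\<close>

lemma prepend_exists:
  assumes a: "a \<in> mors \<Lambda>" and x: "x \<in> path_space k \<Lambda>" and ax: "prng x = src \<Lambda> a"
  shows "\<exists>y. y \<in> path_space k \<Lambda> \<and> pdeg y = xdeg (deg \<Lambda> a) + pdeg x \<and>
             seg y 0 (deg \<Lambda> a) = a \<and> shift k (deg \<Lambda> a) y = x"
proof -
  let ?m = "deg \<Lambda> a"
  define b where "b n = cmp \<Lambda> a (seg x 0 n)" for n
  define d where "d = xdeg ?m + pdeg x"
  define f where "f = restrict (\<lambda>(p, q). middle (b (q - ?m)) p q) (mors (Omega k d))"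
  have m: "?m \<in> degs k"
    using a by simp
  have comp: "(a, seg x 0 n) \<in> composable \<Lambda>" if "n \<in> degs k" "xdeg n \<le> pdeg x" for n
    using seg_functor[OF x zero_le_deg that] a ax by (simp add: composable_iff prng_def)
  have b: "b n \<in> mors \<Lambda>" "deg \<Lambda> (b n) = ?m + n" if "n \<in> degs k" "xdeg n \<le> pdeg x" for n
    using cmp_closed[OF comp[OF that]] seg_functor[OF x zero_le_deg that] by (simp_all add: b_def)
  have b_cmp: "(b n, seg x n n') \<in> composable \<Lambda>" "b n' = cmp \<Lambda> (b n) (seg x n n')"
    if "n \<le> n'" "n' \<in> degs k" "xdeg n' \<le> pdeg x" for n n'
  proof -
    have n: "n \<in> degs k" "xdeg n \<le> pdeg x"
      using that degs_mono xdeg_mono by blast+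
    note c = seg_cmp[OF x zero_le_deg that]
    show "(b n, seg x n n') \<in> composable \<Lambda>" "b n' = cmp \<Lambda> (b n) (seg x n n')"
      using composable_assoc(1)[OF comp[OF n] c(1)] cmp_assoc[OF comp[OF n] c(1)] c(2) by (simp_all add: b_def)
  qed
  have b_head: "head (b n') r = head (b n) r"
    if "n \<le> n'" "n' \<in> degs k" "xdeg n' \<le> pdeg x" "r \<le> ?m + n" for n n' r
  proof -
    have n: "n \<in> degs k" "xdeg n \<le> pdeg x"
      using that degs_mono xdeg_mono by blast+
    show ?thesis
      using b_cmp[OF that(1-3)] head_cmp_le[of "b n" "seg x n n'" r] b[OF n] that(4) by simp
  qed
  have q: "q - ?m \<in> degs k" "xdeg (q - ?m) \<le> pdeg x" if "q \<in> degs k" "xdeg q \<le> d" for q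
    using that xdeg_diff_le by (auto simp: d_def)
  have bq: "b (q - ?m) \<in> mors \<Lambda>" "q \<le> deg \<Lambda> (b (q - ?m))" if "q \<in> degs k" "xdeg q \<le> d" for q
    using b[OF q[OF that]] le_add_deg_diff by auto
  have f: "f (n, p) = middle (b (q - ?m)) n p" if "n \<le> p" "p \<le> q" "q \<in> degs k" "xdeg q \<le> d" for n p q
  proof -
    have p: "p \<in> degs k" "xdeg p \<le> d" "n \<in> degs k"
      using that degs_mono[of q k p] degs_mono[of p k n] xdeg_mono by blast+
    have "head (b (q - ?m)) p = head (b (p - ?m)) p"
      using that q[OF that(3,4)] by (intro b_head) (auto simp: deg_diff_mono le_add_deg_diff)
    then show ?thesis
      using p that by (simp add: f_def mors_Omega middle_def)
  qed
  \<comment> \<open>In each functor law all segments involved can be read off from the single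
    morphism \<open>b (q - ?m)\<close>, where the law is one about middle segments of a fixed
    morphism.\<close>
  have path: "(d, f) \<in> path_space k \<Lambda>"
  proof (rule path_spaceI)
    show "d \<in> degs k"
      using m path_pdeg_degs[OF x] by (simp add: d_def degs_def zero_enat_def)
    show "f \<in> extensional (mors (Omega k d))"
      by (simp add: f_def)
    fix p q assume pq: "p \<le> q" "q \<in> degs k" "xdeg q \<le> d"
    have pd: "p \<le> deg \<Lambda> (b (q - ?m))"
      using bq(2)[OF pq(2,3)] pq(1) by (rule order.trans[rotated])
    show "f (p, q) \<in> mors \<Lambda> \<and> deg \<Lambda> (f (p, q)) = q - p \<and> rng \<Lambda> (f (p, q)) = f (p, p) \<and> src \<Lambda> (f (p, q)) = f (q, q)"
      unfolding f[OF pq(1) order.refl pq(2,3)] f[OF order.refl order.refl pq(2,3)] f[OF order.refl pq]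
      using middle[OF bq(1)[OF pq(2,3)] pq(1) bq(2)[OF pq(2,3)]] middle_refl[OF bq[OF pq(2,3)]]
        middle_refl[OF bq(1)[OF pq(2,3)] pd] by simp
    fix n assume n: "n \<le> p"
    show "f (n, q) = cmp \<Lambda> (f (n, p)) (f (p, q))"
      unfolding f[OF n pq] f[OF pq(1) order.refl pq(2,3)] f[OF order.trans[OF n pq(1)] order.refl pq(2,3)]
      using middle_cmp[OF bq(1)[OF pq(2,3)] n pq(1) bq(2)[OF pq(2,3)]] by simp
  qed
  have "seg (d, f) 0 ?m = a"
  proof -
    have "xdeg 0 \<le> pdeg x"
      by (simp add: le_fun_def flip: zero_enat_def)
    then have "head (b 0) ?m = a"
      using head_cmp[OF comp[of 0] refl] by (simp add: b_def)
    moreover have "tail a 0 = a"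
      using tail_cmp[of "rng \<Lambda> a" a] a by (simp add: composable_iff)
    moreover have "?m - ?m = 0"
      by (rule ext) simp
    moreover have "f (0, ?m) = middle (b (?m - ?m)) 0 ?m"
      using m by (intro f) (auto simp: d_def xdeg_le_add_left)
    ultimately show ?thesis
      by (simp add: seg_def middle_def)
  qed
  moreover have "shift k ?m (d, f) = x"
  proof (rule path_eqI[OF shift_path[OF path m] x])
    show d: "xdeg ?m \<le> pdeg (d, f)" "pdeg (shift k ?m (d, f)) = pdeg x"
      unfolding pdeg_shift by (simp_all add: pdeg_def d_def xdeg_le_add_left)
    fix q assume "q \<in> degs k" "xdeg q \<le> pdeg (shift k ?m (d, f))"
    then have q: "q \<in> degs k" "xdeg q \<le> pdeg x"
      by (simp_all only: d(2))
    have mq: "xdeg (?m + q) \<le> d"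
      unfolding d_def by (rule xdeg_le_add[OF q(2)])
    have "seg (shift k ?m (d, f)) 0 q = f (?m, ?m + q)"
      using seg_shift[OF d(1) zero_le_deg q(1)] mq by (simp add: pdeg_def seg_def)
    also have "\<dots> = middle (b q) ?m (?m + q)"
      using f[of ?m "?m + q" "?m + q"] m q mq by simp
    also have "\<dots> = seg x 0 q"
      using head_deg[OF b(1)[OF q]] b(2)[OF q] tail_cmp[OF comp[OF q]] by (simp add: middle_def b_def)
    finally show "seg (shift k ?m (d, f)) 0 q = seg x 0 q" .
  qed
  ultimately show ?thesis
    using path by (auto simp: pdeg_def d_def)
qed

text \<open>An arbitrary \<open>q\<close> need not be comparable with \<open>m\<close>. Therefore
  the segment of degree \<open>m\<close> is continued by the segment of the shifted path of degree
  \<open>q - m\<close> (truncated), and the segment of degree \<open>q\<close> is cut from the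
  product.\<close>

lemma path_head_shift_eqI:
  assumes y: "y \<in> path_space k \<Lambda>" and z: "z \<in> path_space k \<Lambda>" and m: "m \<in> degs k"
    and my: "xdeg m \<le> pdeg y" and mz: "pdeg z = pdeg y"
    and "seg y 0 m = seg z 0 m" "shift k m y = shift k m z"
  shows "y = z"
proof (rule path_eqI[OF y z mz[symmetric]])
  fix q assume q: "q \<in> degs k" "xdeg q \<le> pdeg y"
  let ?n = "q - m"
  have "xdeg q \<le> xdeg m + (pdeg y - xdeg m)"
  proof (rule le_funI)
    fix i
    have "enat (q i) \<le> pdeg y i" "enat (m i) \<le> pdeg y i"
      using q my by (auto simp: le_fun_def)
    then show "xdeg q i \<le> (xdeg m + (pdeg y - xdeg m)) i"
      by (cases "pdeg y i") auto
  qed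
  \<comment> \<open>\<open>m + ?n\<close> is the join of \<open>m\<close> and \<open>q\<close>, and
    both lie below the degree of the path.\<close>
  then have n: "xdeg (m + ?n) \<le> pdeg y"
    using xdeg_diff_le xdeg_le_diff_iff[OF my] by blast
  have eq: "seg u 0 q = head (cmp \<Lambda> (seg u 0 m) (seg (shift k m u) 0 ?n)) q"
    if u: "u \<in> path_space k \<Lambda>" "pdeg u = pdeg y" for u
  proof -
    have "seg (shift k m u) 0 ?n = seg u m (m + ?n)"
      using seg_shift[of m u 0 ?n] my n q u by simp
    then show ?thesis
      using seg_cmp(2)[OF u(1) zero_le_deg le_add_deg, of m ?n] seg_head(1)[OF u(1) le_add_deg_diff, of m q]
        m q n u by simp
  qed
  show "seg y 0 q = seg z 0 q"
    using eq[OF y refl] eq[OF z mz] assms(6,7) by simp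
qed

text \<open>With existence from \<open>prepend_exists\<close> and uniqueness from
  \<open>path_head_shift_eqI\<close>, the definite description that defines \<open>prepend\<close>
  denotes.\<close>

lemma prepend:
  assumes "a \<in> mors \<Lambda>" "x \<in> path_space k \<Lambda>" "prng x = src \<Lambda> a"
  shows "prepend k \<Lambda> a x \<in> path_space k \<Lambda>" "pdeg (prepend k \<Lambda> a x) = xdeg (deg \<Lambda> a) + pdeg x"
    "seg (prepend k \<Lambda> a x) 0 (deg \<Lambda> a) = a" "shift k (deg \<Lambda> a) (prepend k \<Lambda> a x) = x"
proof -
  have "\<exists>!y. y \<in> path_space k \<Lambda> \<and> pdeg y = xdeg (deg \<Lambda> a) + pdeg x \<and>
             seg y 0 (deg \<Lambda> a) = a \<and> shift k (deg \<Lambda> a) y = x"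
  proof (rule ex_ex1I[OF prepend_exists[OF assms]], elim conjE)
    fix y z
    assume "y \<in> path_space k \<Lambda>" "z \<in> path_space k \<Lambda>" "pdeg y = xdeg (deg \<Lambda> a) + pdeg x"
      "pdeg z = xdeg (deg \<Lambda> a) + pdeg x" "seg y 0 (deg \<Lambda> a) = a" "seg z 0 (deg \<Lambda> a) = a"
      "shift k (deg \<Lambda> a) y = x" "shift k (deg \<Lambda> a) z = x"
    then show "y = z"
      using deg_degs[OF assms(1)] by (intro path_head_shift_eqI[of y z "deg \<Lambda> a"]) (simp_all add: xdeg_le_add_left)
  qed
  from theI'[OF this, folded prepend_def]
  show "prepend k \<Lambda> a x \<in> path_space k \<Lambda>" "pdeg (prepend k \<Lambda> a x) = xdeg (deg \<Lambda> a) + pdeg x"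
    "seg (prepend k \<Lambda> a x) 0 (deg \<Lambda> a) = a" "shift k (deg \<Lambda> a) (prepend k \<Lambda> a x) = x"
    by auto
qed

lemma prng_shift:
  assumes "x \<in> path_space k \<Lambda>" "m \<in> degs k" "xdeg m \<le> pdeg x"
  shows "prng (shift k m x) = src \<Lambda> (seg x 0 m)"
  using seg_shift[of m x 0 0] seg_functor(4)[OF assms(1) zero_le_deg assms(2,3)] assms by (simp add: prng_def)

lemma prepend_seg_shift:
  assumes "x \<in> path_space k \<Lambda>" "m \<in> degs k" "xdeg m \<le> pdeg x"
  shows "prepend k \<Lambda> (seg x 0 m) (shift k m x) = x"
proof -
  note sf = seg_functor[OF assms(1) zero_le_deg assms(2,3)]
  note pr = prepend[OF sf(1) shift_path[OF assms] prng_shift[OF assms]]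
  have d: "deg \<Lambda> (seg x 0 m) = m"
    using sf(2) by simp
  have "xdeg m + (pdeg x - xdeg m) = pdeg x"
  proof (rule ext)
    fix i show "(xdeg m + (pdeg x - xdeg m)) i = pdeg x i"
      using le_funD[OF assms(3), of i] by (cases "pdeg x i") auto
  qed
  then have pd: "pdeg (prepend k \<Lambda> (seg x 0 m) (shift k m x)) = pdeg x"
    using pr(2) d by simp
  show ?thesis
    using pr(3,4) assms(3) unfolding d by (intro path_head_shift_eqI[OF pr(1) assms(1,2)]) (simp_all only: pd)
qed

end

section \<open>Boundary paths have infinite degree\<close>

locale proper_kgraph_no_sources = topological_kgraph +
  assumes proper: "proper_kgraph k \<Lambda>"
    and no_sources: "\<And>v. v \<in> objs \<Lambda> \<Longrightarrow> \<not> is_source k \<Lambda> v"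
begin

lemma set_cmp_objs: "U \<subseteq> objs \<Lambda> \<Longrightarrow> A \<subseteq> mors \<Lambda> \<Longrightarrow> set_cmp \<Lambda> U A = {a \<in> A. rng \<Lambda> a \<in> U}"
proof (intro equalityI subsetI)
  fix c assume U: "U \<subseteq> objs \<Lambda>" and "c \<in> set_cmp \<Lambda> U A"
  then obtain a b where ab: "c = cmp \<Lambda> a b" "a \<in> U" "b \<in> A" "b \<in> mors \<Lambda>" "src \<Lambda> a = rng \<Lambda> b"
    by (auto simp: set_cmp_def composable_iff)
  then have "rng \<Lambda> b = a"
    using U src_obj by auto
  then show "c \<in> {a \<in> A. rng \<Lambda> a \<in> U}"
    using ab by auto
next
  fix c assume U: "U \<subseteq> objs \<Lambda>" "A \<subseteq> mors \<Lambda>" and c: "c \<in> {a \<in> A. rng \<Lambda> a \<in> U}"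
  then have "(rng \<Lambda> c, c) \<in> composable \<Lambda>" "c = cmp \<Lambda> (rng \<Lambda> c) c"
    by (auto simp: composable_iff subset_iff)
  then show "c \<in> set_cmp \<Lambda> U A"
    using c unfolding set_cmp_def by blast
qed

lemma level_mors: "level \<Lambda> m \<subseteq> mors \<Lambda>"
  by (auto simp: level_def)

lemma edge_exists:
  assumes "v \<in> objs \<Lambda>" "i < k"
  obtains e where "e \<in> mors \<Lambda>" "rng \<Lambda> e = v" "deg \<Lambda> e = unit_deg i"
proof -
  have "set_cmp \<Lambda> {v} (level \<Lambda> (unit_deg i)) \<noteq> {}"
    using no_sources[OF assms(1)] assms by (auto simp: is_source_def)
  then show ?thesis
    using assms that set_cmp_objs[of "{v}", OF _ level_mors] by (auto simp: level_def)
qed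

text \<open>If \<open>l\<close> has positive degree in direction \<open>i\<close>, its own initial
  edge serves as \<open>\<mu>\<close>. Otherwise an edge \<open>e\<close> of degree
  \<open>unit_deg i\<close> at the source of \<open>l\<close> exists because there are no sources;
  adding this degree is then the same as joining with it, and \<open>\<mu>\<close> is the initial
  edge of the product \<open>l e\<close>.\<close>

lemma min_ext_edge:
  assumes l: "l \<in> mors \<Lambda>" and i: "i < k"
  shows "\<exists>\<mu>\<in>mors \<Lambda>. deg \<Lambda> \<mu> = unit_deg i \<and> rng \<Lambda> \<mu> = rng \<Lambda> l \<and> min_ext \<Lambda> l \<mu> \<noteq> {}"
proof -
  let ?u = "unit_deg i"
  have "\<exists>e\<in>mors \<Lambda>. (l, e) \<in> composable \<Lambda> \<and> ?u \<le> deg \<Lambda> (cmp \<Lambda> l e) \<and> deg \<Lambda> (cmp \<Lambda> l e) = sup (deg \<Lambda> l) ?u"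
  proof (cases "?u \<le> deg \<Lambda> l")
    case True
    then show ?thesis
      using l by (intro bexI[where x = "src \<Lambda> l"]) (auto simp: composable_iff sup_absorb1)
  next
    case False
    then have 0: "deg \<Lambda> l i = 0"
      by (auto simp: le_fun_def unit_deg_def split: if_splits)
    obtain e where e: "e \<in> mors \<Lambda>" "rng \<Lambda> e = src \<Lambda> l" "deg \<Lambda> e = ?u"
      using edge_exists[OF src_objs[OF l] i] .
    then have c: "(l, e) \<in> composable \<Lambda>"
      using l by (simp add: composable_iff)
    have "deg \<Lambda> l + ?u = sup (deg \<Lambda> l) ?u"
      using 0 by (auto simp: fun_eq_iff unit_deg_def sup_max)
    then show ?thesis
      using c e cmp_closed(4)[OF c] by (intro bexI[where x = e]) auto
  qed
  then obtain e where e: "(l, e) \<in> composable \<Lambda>" "?u \<le> deg \<Lambda> (cmp \<Lambda> l e)"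
    "deg \<Lambda> (cmp \<Lambda> l e) = sup (deg \<Lambda> l) ?u"
    by blast
  let ?\<mu> = "head (cmp \<Lambda> l e) ?u" and ?\<beta> = "tail (cmp \<Lambda> l e) ?u"
  note ht = head_tail[OF cmp_closed(1)[OF e(1)] e(2)]
  have "rng \<Lambda> ?\<mu> = rng \<Lambda> l"
    using cmp_closed(2)[OF e(1)] cmp_closed(2)[OF ht(1)] ht(2) by simp
  moreover have "(e, ?\<beta>) \<in> min_ext \<Lambda> l ?\<mu>"
    using e ht by (simp add: min_ext_def)
  ultimately show ?thesis
    using ht(1,3) by (auto simp: composable_iff)
qed

text \<open>The definition of \<open>compact_exhaustive\<close> refers to the range of
  \<open>E\<close>, not to \<open>K\<close>. The two agree because every vertex of \<open>K\<close>
  receives an edge in direction \<open>i\<close>; so the range is a neighbourhood of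
  \<open>v\<close>.\<close>

lemma edges_compact_exhaustive:
  assumes v: "v \<in> objs \<Lambda>" and i: "i < k"
  obtains E where "E \<in> compact_exhaustive \<Lambda> v" "E \<subseteq> level \<Lambda> (unit_deg i)"
proof -
  obtain W K where WK: "openin (Obj \<Lambda>) W" "compactin (Obj \<Lambda>) K" "v \<in> W" "W \<subseteq> K"
    using obj_space(2) v unfolding locally_compact_space_def by blast
  have K: "K \<subseteq> objs \<Lambda>"
    using WK(2) compactin_subset_topspace by blast
  define E where "E = set_cmp \<Lambda> K (level \<Lambda> (unit_deg i))"
  have E: "E = {a \<in> level \<Lambda> (unit_deg i). rng \<Lambda> a \<in> K}"
    unfolding E_def by (rule set_cmp_objs[OF K level_mors])
  have "K \<subseteq> rng \<Lambda> ` E"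
  proof
    fix w assume w: "w \<in> K"
    then obtain e where "e \<in> mors \<Lambda>" "rng \<Lambda> e = w" "deg \<Lambda> e = unit_deg i"
      using edge_exists[of w i] K i by blast
    then show "w \<in> rng \<Lambda> ` E"
      using w by (auto simp: E level_def)
  qed
  then have rE: "rng \<Lambda> ` E = K"
    by (auto simp: E)
  have "exhaustive \<Lambda> K E"
    unfolding exhaustive_def set_cmp_objs[OF K order.refl]
  proof (intro conjI ballI)
    show "E \<subseteq> {a \<in> mors \<Lambda>. rng \<Lambda> a \<in> K}"
      by (auto simp: E level_def)
    fix l assume "l \<in> {a \<in> mors \<Lambda>. rng \<Lambda> a \<in> K}"
    then show "\<exists>\<mu>\<in>E. min_ext \<Lambda> l \<mu> \<noteq> {}"
      using min_ext_edge[of l i] i by (auto simp: E level_def)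
  qed
  moreover have "compactin (Mor \<Lambda>) E"
    using proper WK(2) i by (simp add: proper_kgraph_def E_def)
  ultimately have "E \<in> compact_exhaustive \<Lambda> v"
    using WK rE by (auto simp: compact_exhaustive_def)
  then show ?thesis
    using that E by blast
qed

lemma boundary_path_space: "x \<in> boundary_paths k \<Lambda> \<Longrightarrow> x \<in> path_space k \<Lambda>"
  by (simp add: boundary_paths_def)

lemma boundary_exhaustive:
  assumes "x \<in> boundary_paths k \<Lambda>" "m \<in> degs k" "xdeg m \<le> pdeg x" "E \<in> compact_exhaustive \<Lambda> (seg x m m)"
  obtains l where "l \<in> E" "xdeg (m + deg \<Lambda> l) \<le> pdeg x" "seg x m (m + deg \<Lambda> l) = l"
  using assms unfolding boundary_paths_def by blast

text \<open>If the degree in direction \<open>i\<close> were a finite \<open>N\<close>,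
  exhaustiveness of the edges at the vertex reached after \<open>N\<close> steps in that direction
  would produce an edge along which the path continues beyond \<open>N\<close>.\<close>

lemma boundary_pdeg:
  assumes x: "x \<in> boundary_paths k \<Lambda>"
  shows "pdeg x = (\<lambda>i. if i < k then \<infinity> else 0)"
proof (rule ext)
  fix i
  have "pdeg x i = \<infinity>" if i: "i < k"
  proof (rule ccontr)
    assume "pdeg x i \<noteq> \<infinity>"
    then obtain N where N: "pdeg x i = enat N"
      by auto
    \<comment> \<open>All other coordinates are 0, which keeps \<open>m\<close> below the degree of
      \<open>x\<close> whatever its remaining coordinates are.\<close>
    define m where "m = (\<lambda>j. if j = i then N else 0)"
    have m: "m \<in> degs k" "xdeg m \<le> pdeg x"
      using i N by (auto simp: m_def degs_def le_fun_def simp flip: zero_enat_def)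
    obtain E where E: "E \<in> compact_exhaustive \<Lambda> (seg x m m)" "E \<subseteq> level \<Lambda> (unit_deg i)"
      using edges_compact_exhaustive[OF seg_objs[OF boundary_path_space[OF x] m] i] .
    then obtain l where "l \<in> E" "xdeg (m + deg \<Lambda> l) \<le> pdeg x"
      using boundary_exhaustive[OF x m] by blast
    then have "xdeg (m + unit_deg i) i \<le> pdeg x i"
      using E(2) by (auto simp: level_def le_fun_def)
    then show False
      by (simp add: N m_def unit_deg_def)
  qed
  then show "pdeg x i = (if i < k then \<infinity> else 0)"
    using path_pdeg_degs[OF boundary_path_space[OF x]] by (auto simp: degs_def)
qed

text \<open>As a simp rule this discharges the condition that a segment or a shift is defined, so
  that it disappears from all later statements on boundary paths.\<close>

lemma boundary_xdeg [simp]: "x \<in> boundary_paths k \<Lambda> \<Longrightarrow> n \<in> degs k \<Longrightarrow> xdeg n \<le> pdeg x"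
  by (auto simp: boundary_pdeg le_fun_def degs_def zero_enat_def)

text \<open>The boundary condition for the shifted path at \<open>m\<close> is the condition for
  \<open>x\<close> at \<open>n + m\<close>, since both vertices and segments correspond under the
  shift.\<close>

lemma boundary_shift [simp]:
  assumes x: "x \<in> boundary_paths k \<Lambda>" and n: "n \<in> degs k"
  shows "shift k n x \<in> boundary_paths k \<Lambda>"
proof -
  have nx: "xdeg n \<le> pdeg x"
    using assms by simp
  show ?thesis
    unfolding boundary_paths_def
  proof (intro CollectI conjI ballI impI)
    show "shift k n x \<in> path_space k \<Lambda>"
      using shift_path[OF boundary_path_space[OF x] n nx] .
    fix m E assume m: "m \<in> degs k" "xdeg m \<le> pdeg (shift k n x)"
      and E: "E \<in> compact_exhaustive \<Lambda> (seg (shift k n x) m m)"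
    have "seg (shift k n x) m m = seg x (n + m) (n + m)"
      using x n m by (intro seg_shift) auto
    then obtain l where l: "l \<in> E" "xdeg (n + m + deg \<Lambda> l) \<le> pdeg x" "seg x (n + m) (n + m + deg \<Lambda> l) = l"
      using boundary_exhaustive[OF x, of "n + m" E] E m n xdeg_le_diff_iff[OF nx, of m] by auto
    have "l \<in> mors \<Lambda>"
      using E l(1) compactin_subset_topspace by (auto simp: compact_exhaustive_def)
    then have "m + deg \<Lambda> l \<in> degs k"
      using m by simp
    then have "seg (shift k n x) m (m + deg \<Lambda> l) = l" "xdeg (m + deg \<Lambda> l) \<le> pdeg (shift k n x)"
      using l nx seg_shift[OF nx, of m "m + deg \<Lambda> l"] xdeg_le_diff_iff[OF nx, of "m + deg \<Lambda> l"]
      by (simp_all add: add.assoc)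
    then show "\<exists>l\<in>E. xdeg (m + deg \<Lambda> l) \<le> pdeg (shift k n x) \<and> seg (shift k n x) m (m + deg \<Lambda> l) = l"
      using l(1) by blast
  qed
qed

section \<open>Segments, shifts and arrows of boundary paths\<close>

lemma boundary_path_eqI:
  assumes "x \<in> boundary_paths k \<Lambda>" "y \<in> boundary_paths k \<Lambda>"
    and "\<And>q. q \<in> degs k \<Longrightarrow> seg x 0 q = seg y 0 q"
  shows "x = y"
  using assms by (intro path_eqI) (auto simp: boundary_path_space boundary_pdeg)

lemma boundary_seg:
  assumes "x \<in> boundary_paths k \<Lambda>" "p \<le> q" "q \<in> degs k"
  shows "seg x p q \<in> mors \<Lambda>" "deg \<Lambda> (seg x p q) = q - p"
    "head (seg x 0 q) p = seg x 0 p" "tail (seg x 0 q) p = seg x p q"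
proof -
  note x = boundary_path_space[OF assms(1)] assms(2,3) boundary_xdeg[OF assms(1,3)]
  show "seg x p q \<in> mors \<Lambda>" "deg \<Lambda> (seg x p q) = q - p"
    using seg_functor[OF x] by blast+
  show "head (seg x 0 q) p = seg x 0 p" "tail (seg x 0 q) p = seg x p q"
    using seg_head[OF x] by (blast intro: sym)+
qed

lemma boundary_seg_0:
  assumes "x \<in> boundary_paths k \<Lambda>" "q \<in> degs k"
  shows "seg x 0 q \<in> mors \<Lambda>" "deg \<Lambda> (seg x 0 q) = q" "src \<Lambda> (seg x 0 q) = prng (shift k q x)"
  using boundary_seg[OF assms(1) zero_le_deg assms(2)] prng_shift[OF boundary_path_space[OF assms(1)] assms(2)] assms
  by auto

lemma boundary_seg_shift:
  assumes "x \<in> boundary_paths k \<Lambda>" "m \<in> degs k" "q \<in> degs k"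
  shows "seg (shift k m x) 0 q = seg x m (m + q)"
  using seg_shift[of m x 0 q] assms by simp

lemma boundary_shift_shift:
  assumes "x \<in> boundary_paths k \<Lambda>" "m \<in> degs k" "n \<in> degs k"
  shows "shift k n (shift k m x) = shift k (m + n) x"
  using assms by (intro shift_shift) (auto simp: boundary_path_space)

text \<open>\<open>p\<close> and \<open>q\<close> witness that \<open>(x, m, y)\<close> is an arrow.\<close>

definition lag :: "'a kpath \<Rightarrow> (nat \<Rightarrow> int) \<Rightarrow> 'a kpath \<Rightarrow> (nat \<Rightarrow> nat) \<Rightarrow> (nat \<Rightarrow> nat) \<Rightarrow> bool" where
  "lag x m y p q \<longleftrightarrow> p \<in> degs k \<and> q \<in> degs k \<and> m = deg_int p - deg_int q \<and> shift k p x = shift k q y"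

text \<open>If x = az and y = bz, then the degrees of \<open>a\<close> and \<open>b\<close> are
  witnesses and \<open>a\<close>, \<open>b\<close> are the corresponding initial segments.
  Conversely, infinite degree guarantees that x(0, p), y(0, q) and the common shifted path exist for
  any witnesses. From here on \<open>prepend\<close> is replaced by segments.\<close>

lemma Zset_boundary:
  assumes x: "x \<in> boundary_paths k \<Lambda>" and y: "y \<in> boundary_paths k \<Lambda>"
  shows "(x, m, y) \<in> Zset k \<Lambda> F m' \<longleftrightarrow> m = m' \<and> (\<exists>p q. lag x m y p q \<and> (seg x 0 p, seg y 0 q) \<in> F)"
proof
  assume "(x, m, y) \<in> Zset k \<Lambda> F m'"
  then obtain a b z where ab: "x = prepend k \<Lambda> a z" "y = prepend k \<Lambda> b z" "m = deg_diff \<Lambda> a b" "m = m'"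
    "(a, b) \<in> F" "a \<in> mors \<Lambda>" "b \<in> mors \<Lambda>" "src \<Lambda> a = src \<Lambda> b" "z \<in> path_space k \<Lambda>" "prng z = src \<Lambda> a"
    by (auto simp: Zset_def src_pairs_def)
  then have "lag x m y (deg \<Lambda> a) (deg \<Lambda> b)" "(seg x 0 (deg \<Lambda> a), seg y 0 (deg \<Lambda> b)) \<in> F"
    using prepend[of a z] prepend[of b z] by (auto simp: lag_def deg_diff_def deg_int_def)
  with \<open>m = m'\<close> show "m = m' \<and> (\<exists>p q. lag x m y p q \<and> (seg x 0 p, seg y 0 q) \<in> F)"
    by blast
next
  assume "m = m' \<and> (\<exists>p q. lag x m y p q \<and> (seg x 0 p, seg y 0 q) \<in> F)"
  then obtain p q where m: "m = m'" and pq: "p \<in> degs k" "q \<in> degs k" "m = deg_int p - deg_int q"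
    "shift k p x = shift k q y" "(seg x 0 p, seg y 0 q) \<in> F"
    by (auto simp: lag_def)
  let ?a = "seg x 0 p" and ?b = "seg y 0 q" and ?z = "shift k p x"
  have "x = prepend k \<Lambda> ?a ?z" "y = prepend k \<Lambda> ?b ?z"
    using prepend_seg_shift[of x p] prepend_seg_shift[of y q] x y pq by (auto simp: boundary_path_space)
  moreover have "m = deg_diff \<Lambda> ?a ?b"
    using boundary_seg_0 x y pq by (auto simp: deg_diff_def deg_int_def)
  moreover have "(?a, ?b) \<in> src_pairs \<Lambda>" "prng ?z = src \<Lambda> ?a"
    using boundary_seg_0[of x p] boundary_seg_0[of y q] x y pq by (auto simp: src_pairs_def)
  moreover have "?z \<in> path_space k \<Lambda>"
    using boundary_shift[OF x pq(1)] by (rule boundary_path_space)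
  ultimately show "(x, m, y) \<in> Zset k \<Lambda> F m'"
    using m pq(5) unfolding Zset_def by blast
qed

lemma path_arrows_Zset: "(x, m, y) \<in> path_arrows k \<Lambda> \<longleftrightarrow> (x, m, y) \<in> Zset k \<Lambda> (src_pairs \<Lambda>) m"
  by (auto simp: path_arrows_def Zset_def)

lemma path_arrows_boundary:
  assumes "x \<in> boundary_paths k \<Lambda>" "y \<in> boundary_paths k \<Lambda>"
  shows "(x, m, y) \<in> path_arrows k \<Lambda> \<longleftrightarrow> (\<exists>p q. lag x m y p q)"
proof -
  have "(seg x 0 p, seg y 0 q) \<in> src_pairs \<Lambda>" if "lag x m y p q" for p q
    using that boundary_seg_0[of x p] boundary_seg_0[of y q] assms by (auto simp: src_pairs_def lag_def)
  then show ?thesis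
    using path_arrows_Zset Zset_boundary[OF assms] by blast
qed

end

section \<open>Topology of the boundary-path groupoid\<close>

lemma punit_image_iff [simp]: "punit x \<in> punit ` B \<longleftrightarrow> x \<in> B"
  by (auto simp: punit_def)

context proper_kgraph_no_sources
begin

abbreviation "bpaths \<equiv> boundary_paths k \<Lambda>"

abbreviation "bgrp \<equiv> boundary_path_groupoid k \<Lambda>"

lemma bgrp_simps [simp]:
  "grng bgrp (x, m, y) = punit x" "gsrc bgrp (x, m, y) = punit y"
  "gmult bgrp (x, m, y) (y', n, z) = (x, m + n, z)"
  by (simp_all add: boundary_path_groupoid_def reduction_def path_groupoid_def)

lemma gtop_bgrp:
  "gtop bgrp = subtopology (topology_generated_by (path_groupoid_basis k \<Lambda>)) {(x, m, y). x \<in> bpaths \<and> y \<in> bpaths}"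
proof -
  have "{g. grng (path_groupoid k \<Lambda>) g \<in> punit ` bpaths \<and> gsrc (path_groupoid k \<Lambda>) g \<in> punit ` bpaths} =
      {(x, m, y). x \<in> bpaths \<and> y \<in> bpaths}"
    by (rule set_eqI) (simp add: path_groupoid_def case_prod_unfold)
  then show ?thesis
    by (simp add: boundary_path_groupoid_def reduction_def) (simp add: path_groupoid_def)
qed

text \<open>\<open>topology_generated_by\<close> takes the union of the generators as its space, so
  this identifies the underlying set of the groupoid.\<close>

lemma Union_path_groupoid_basis: "\<Union> (path_groupoid_basis k \<Lambda>) = path_arrows k \<Lambda>"
proof
  show "\<Union> (path_groupoid_basis k \<Lambda>) \<subseteq> path_arrows k \<Lambda>"
    by (auto simp: path_groupoid_basis_def)
  show "path_arrows k \<Lambda> \<subseteq> \<Union> (path_groupoid_basis k \<Lambda>)"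
  proof
    fix g assume g: "g \<in> path_arrows k \<Lambda>"
    then obtain a b x where ab: "g = (prepend k \<Lambda> a x, deg_diff \<Lambda> a b, prepend k \<Lambda> b x)"
      "(a, b) \<in> src_pairs \<Lambda>" "x \<in> path_space k \<Lambda>" "prng x = src \<Lambda> a"
      by (auto simp: path_arrows_def)
    define m where "m = deg_diff \<Lambda> a b"
    have "a \<in> mors \<Lambda>" "b \<in> mors \<Lambda>"
      using ab(2) by (auto simp: src_pairs_def)
    then have "deg \<Lambda> a \<in> degs k" "deg \<Lambda> b \<in> degs k"
      by simp_all
    then have "m \<in> degs k"
      by (auto simp: m_def deg_diff_def degs_def)
    then have "Zset k \<Lambda> ((mors \<Lambda> \<times> mors \<Lambda>) \<inter> src_pairs \<Lambda>) m \<inter> (path_arrows k \<Lambda> - Zset k \<Lambda> {} m) \<in> path_groupoid_basis k \<Lambda>"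
      unfolding path_groupoid_basis_def by blast
    moreover have "g \<in> Zset k \<Lambda> ((mors \<Lambda> \<times> mors \<Lambda>) \<inter> src_pairs \<Lambda>) m"
      using ab \<open>a \<in> mors \<Lambda>\<close> \<open>b \<in> mors \<Lambda>\<close> unfolding Zset_def m_def by blast
    moreover have "g \<notin> Zset k \<Lambda> {} m"
      by (simp add: Zset_def)
    ultimately show "g \<in> \<Union> (path_groupoid_basis k \<Lambda>)"
      using g by blast
  qed
qed

lemma bgrp_topspace_iff:
  "(x, m, y) \<in> topspace (gtop bgrp) \<longleftrightarrow> x \<in> bpaths \<and> y \<in> bpaths \<and> (\<exists>p q. lag x m y p q)"
  using path_arrows_boundary[of x y m]
  by (simp add: gtop_bgrp topology_generated_by_topspace Union_path_groupoid_basis) blast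

lemma bgrp_topspaceD: "g \<in> topspace (gtop bgrp) \<Longrightarrow> fst g \<in> bpaths"
  by (cases g) (simp add: bgrp_topspace_iff)

lemma punit_arrow:
  assumes "x \<in> bpaths"
  shows "punit x \<in> topspace (gtop bgrp)"
proof -
  have "lag x 0 x 0 0"
    by (simp add: lag_def)
  then show ?thesis
    using assms unfolding punit_def bgrp_topspace_iff by blast
qed

lemma gunits_bgrp: "gunits bgrp = punit ` bpaths"
proof
  show "punit ` bpaths \<subseteq> gunits bgrp"
  proof (rule image_subsetI)
    fix x assume "x \<in> bpaths"
    then show "punit x \<in> gunits bgrp"
      unfolding gunits_def using punit_arrow by (intro image_eqI[where x = "punit x"]) (simp_all add: punit_def)
  qed
next
  show "gunits bgrp \<subseteq> punit ` bpaths"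
  proof
    fix u assume "u \<in> gunits bgrp"
    then obtain x m y where "u = grng bgrp (x, m, y)" "(x, m, y) \<in> topspace (gtop bgrp)"
      by (auto simp only: gunits_def)
    then show "u \<in> punit ` bpaths"
      by (simp add: bgrp_topspace_iff)
  qed
qed

lemma gfibre_bgrp: "g \<in> gfibre bgrp (punit x) \<longleftrightarrow> g \<in> topspace (gtop bgrp) \<and> fst g = x"
  by (cases g) (simp add: gfibre_def punit_def)

text \<open>The trace on boundary paths of the set Z(F, m) with F the source-matched pairs in U x V.
  Nothing is removed from these sets; they provide all open neighbourhoods that are written down
  explicitly below.\<close>

definition basic_arrows :: "'a set \<Rightarrow> 'a set \<Rightarrow> (nat \<Rightarrow> int) \<Rightarrow> 'a path_arrow set" where
  "basic_arrows U V m = {(x, m', y). x \<in> bpaths \<and> y \<in> bpaths \<and> m' = m \<and>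
     (\<exists>p q. lag x m y p q \<and> seg x 0 p \<in> U \<and> seg y 0 q \<in> V)}"

lemma basic_arrows_iff:
  "(x, m', y) \<in> basic_arrows U V m \<longleftrightarrow> x \<in> bpaths \<and> y \<in> bpaths \<and> m' = m \<and>
     (\<exists>p q. lag x m y p q \<and> seg x 0 p \<in> U \<and> seg y 0 q \<in> V)"
  by (simp add: basic_arrows_def)

lemma lag_degs: "lag x m y p q \<Longrightarrow> m \<in> degs k"
  by (auto simp: lag_def degs_def deg_int_def)

lemma lag_src_pairs:
  "x \<in> bpaths \<Longrightarrow> y \<in> bpaths \<Longrightarrow> lag x m y p q \<Longrightarrow> (seg x 0 p, seg y 0 q) \<in> src_pairs \<Lambda>"
  using boundary_seg_0[of x p] boundary_seg_0[of y q] by (auto simp: src_pairs_def lag_def)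

lemma openin_basic_arrows:
  assumes "openin (Mor \<Lambda>) U" "openin (Mor \<Lambda>) V"
  shows "openin (gtop bgrp) (basic_arrows U V m)"
proof (cases "m \<in> degs k")
  case True
  let ?P = "Zset k \<Lambda> ((U \<times> V) \<inter> src_pairs \<Lambda>) m \<inter> (path_arrows k \<Lambda> - Zset k \<Lambda> {} m)"
  have "?P \<in> path_groupoid_basis k \<Lambda>"
    using True assms unfolding path_groupoid_basis_def by blast
  then have "openin (gtop bgrp) (?P \<inter> {(x, m, y). x \<in> bpaths \<and> y \<in> bpaths})"
    unfolding gtop_bgrp by (intro openin_subtopology_Int topology_generated_by_Basis)
  moreover have "?P \<inter> {(x, m, y). x \<in> bpaths \<and> y \<in> bpaths} = basic_arrows U V m"
  proof (rule set_eqI)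
    fix g :: "'a path_arrow"
    obtain x n y where g: "g = (x, n, y)"
      using prod_cases3 by blast
    show "g \<in> ?P \<inter> {(x, m, y). x \<in> bpaths \<and> y \<in> bpaths} \<longleftrightarrow> g \<in> basic_arrows U V m"
    proof (cases "x \<in> bpaths \<and> y \<in> bpaths")
      case True
      then show ?thesis
        using lag_src_pairs[of x y m] unfolding g
        by (simp add: basic_arrows_iff Zset_boundary path_arrows_boundary) blast
    next
      case False
      then show ?thesis
        unfolding g by (simp add: basic_arrows_iff) blast
    qed
  qed
  ultimately show ?thesis
    by simp
next
  case False
  then have "basic_arrows U V m = {}"
    using lag_degs by (auto simp: basic_arrows_def)
  then show ?thesis
    by simp
qed

text \<open>Enlarging witnesses serves two purposes: making an initial segment long enough to
  contain a given one, and matching the witnesses of two arrows that are to be composed.\<close>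

lemma lag_add:
  assumes "x \<in> bpaths" "y \<in> bpaths" "lag x m y p q" "r \<in> degs k"
  shows "lag x m y (p + r) (q + r)"
  using assms boundary_shift_shift[of x p r] boundary_shift_shift[of y q r]
  by (auto simp: lag_def deg_int_def)

text \<open>A witness \<open>r\<close> of the arrow may fail to dominate \<open>p\<close>, so it is
  enlarged to \<open>r + p\<close>. Then x(0, p) is the head of the longer segment, and requiring
  that head to lie in \<open>U\<close> is an open condition on the longer segment.\<close>

lemma range_seg_0_continuous:
  assumes p: "p \<in> degs k"
  shows "continuous_map (gtop bgrp) (Mor \<Lambda>) (\<lambda>g. seg (fst g) 0 p)"
  unfolding continuous_map_def
proof (intro conjI allI impI)
  show "(\<lambda>g. seg (fst g) 0 p) \<in> topspace (gtop bgrp) \<rightarrow> mors \<Lambda>"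
    using boundary_seg_0 p bgrp_topspaceD by blast
  fix U assume U: "openin (Mor \<Lambda>) U"
  let ?U = "{a \<in> mors \<Lambda>. p \<le> deg \<Lambda> a \<and> head a p \<in> U}"
  show "openin (gtop bgrp) {g \<in> topspace (gtop bgrp). seg (fst g) 0 p \<in> U}"
  proof (subst openin_subopen, intro ballI)
    fix g assume g: "g \<in> {g \<in> topspace (gtop bgrp). seg (fst g) 0 p \<in> U}"
    then obtain x m y r s where g_eq: "g = (x, m, y)" and xy: "x \<in> bpaths" "y \<in> bpaths" "lag x m y r s"
      using bgrp_topspace_iff by (cases g) fastforce
    then have xp: "seg x 0 p \<in> U"
      using g by simp
    have "lag x m y (r + p) (s + p)" "r + p \<in> degs k" "p \<le> r + p" "s + p \<in> degs k"
      using lag_add[OF xy p] xy(3) p by (auto simp: lag_def le_fun_def)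
    then have "lag x m y (r + p) (s + p) \<and> seg x 0 (r + p) \<in> ?U \<and> seg y 0 (s + p) \<in> mors \<Lambda>"
      using xy xp boundary_seg_0[OF xy(1), of "r + p"] boundary_seg_0[OF xy(2), of "s + p"]
        boundary_seg(3)[OF xy(1), of p "r + p"]
      by simp
    then have "(x, m, y) \<in> basic_arrows ?U (mors \<Lambda>) m"
      using xy unfolding basic_arrows_iff by blast
    moreover have "basic_arrows ?U (mors \<Lambda>) m \<subseteq> {g \<in> topspace (gtop bgrp). seg (fst g) 0 p \<in> U}"
    proof
      fix h assume "h \<in> basic_arrows ?U (mors \<Lambda>) m"
      then obtain x' y' r' s' where h: "h = (x', m, y')" "x' \<in> bpaths" "y' \<in> bpaths"
        and r: "lag x' m y' r' s'" "seg x' 0 r' \<in> ?U"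
        unfolding basic_arrows_def by blast
      then have "head (seg x' 0 r') p = seg x' 0 p"
        using boundary_seg_0[of x' r'] by (intro boundary_seg(3)) (auto simp: lag_def)
      then show "h \<in> {g \<in> topspace (gtop bgrp). seg (fst g) 0 p \<in> U}"
        using h r bgrp_topspace_iff by auto
    qed
    ultimately show "\<exists>T. openin (gtop bgrp) T \<and> g \<in> T \<and> T \<subseteq> {g \<in> topspace (gtop bgrp). seg (fst g) 0 p \<in> U}"
      using openin_basic_arrows[OF openin_head_preimage[OF U] openin_topspace] unfolding g_eq by blast
  qed
qed

lemma range_seg_continuous:
  assumes n: "n \<le> q" and q: "q \<in> degs k"
  shows "continuous_map (gtop bgrp) (Mor \<Lambda>) (\<lambda>g. seg (fst g) n q)"
  unfolding continuous_map_def
proof (intro conjI allI impI)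
  show "(\<lambda>g. seg (fst g) n q) \<in> topspace (gtop bgrp) \<rightarrow> mors \<Lambda>"
    using boundary_seg(1) n q bgrp_topspaceD by blast
  fix U assume U: "openin (Mor \<Lambda>) U"
  have "{g \<in> topspace (gtop bgrp). seg (fst g) n q \<in> U} =
    {g \<in> topspace (gtop bgrp). seg (fst g) 0 q \<in> {a \<in> mors \<Lambda>. n \<le> deg \<Lambda> a \<and> tail a n \<in> U}}"
    using boundary_seg_0[OF bgrp_topspaceD q] boundary_seg(4)[OF bgrp_topspaceD n q] n by auto
  then show "openin (gtop bgrp) {g \<in> topspace (gtop bgrp). seg (fst g) n q \<in> U}"
    using openin_continuous_map_preimage[OF range_seg_0_continuous[OF q] openin_tail_preimage[OF U, of n]] by simp
qed

section \<open>The arrows from a path to its shifts\<close>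

definition shift_arrow :: "'a kpath \<Rightarrow> (nat \<Rightarrow> nat) \<Rightarrow> 'a path_arrow" where
  "shift_arrow x n = (x, deg_int n, shift k n x)"

text \<open>The integer component already forces \<open>p = n + q\<close>, after which equality of
  the shifts is automatic. Hence these arrows have one witness pair for each degree
  \<open>q\<close>.\<close>

lemma lag_deg_int:
  assumes "x \<in> bpaths" "n \<in> degs k"
  shows "lag x (deg_int n) (shift k n x) p q \<longleftrightarrow> q \<in> degs k \<and> p = n + q"
proof -
  have "deg_int n = deg_int p - deg_int q \<longleftrightarrow> p = n + q"
  proof -
    have "int (n i) = int (p i) - int (q i) \<longleftrightarrow> p i = n i + q i" for i
      by linarith
    then show ?thesis
      by (simp add: deg_int_def fun_eq_iff)
  qed
  then show ?thesis
    using assms boundary_shift_shift[OF assms] by (auto simp: lag_def)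
qed

lemma shift_arrow_fibre:
  assumes "x \<in> bpaths" "n \<in> degs k"
  shows "shift_arrow x n \<in> gfibre bgrp (punit x)"
proof -
  have "lag x (deg_int n) (shift k n x) n 0"
    using lag_deg_int[OF assms, of n 0] by simp
  then show ?thesis
    using assms boundary_shift[OF assms] unfolding shift_arrow_def gfibre_bgrp bgrp_topspace_iff by auto
qed

text \<open>A compact subset of a discrete space is finite. This makes the union that describes a
  removed set in the continuity proof finite, hence closed.\<close>

lemma finite_compact_degrees:
  assumes "compactin (prod_topology (Mor \<Lambda>) (Mor \<Lambda>)) F"
  shows "finite ((\<lambda>(a, b). deg \<Lambda> b) ` F)"
proof -
  have "continuous_map (prod_topology (Mor \<Lambda>) (Mor \<Lambda>)) (discrete_topology (degs k)) (deg \<Lambda> \<circ> snd)"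
    using deg_continuous continuous_map_compose continuous_map_snd by blast
  then have "compactin (discrete_topology (degs k)) ((deg \<Lambda> \<circ> snd) ` F)"
    using assms image_compactin by blast
  then have "finite ((deg \<Lambda> \<circ> snd) ` F)"
    by (simp add: compactin_discrete_topology)
  then show ?thesis
    by (simp add: case_prod_unfold comp_def)
qed

text \<open>The arrow from \<open>x\<close> with index \<open>n\<close> lies in Z(E, m), for m = n,
  exactly if (x(0, n+q), x(n, n+q)) lies in E for some \<open>q\<close>, and both segments depend
  continuously on \<open>x\<close>. For the open part of a basic set the union over all
  \<open>q\<close> is open; for the removed compact \<open>F\<close> finitely many \<open>q\<close>
  suffice and each contributes a closed set.\<close>

lemma shift_arrow_continuous:
  assumes n: "n \<in> degs k"
  shows "continuous_map (subtopology (gtop bgrp) (gunits bgrp)) (gtop bgrp) (\<lambda>g. shift_arrow (fst g) n)"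
proof -
  let ?T = "subtopology (gtop bgrp) (gunits bgrp)"
  let ?f = "\<lambda>g :: 'a path_arrow. shift_arrow (fst g) n"
  have top: "topspace ?T = punit ` bpaths"
    using punit_arrow by (auto simp: gunits_bgrp)
  have f: "?f (punit x) = (x, deg_int n, shift k n x)" for x
    by (simp add: shift_arrow_def punit_def)
  have f_top: "?f ` topspace ?T \<subseteq> topspace (gtop bgrp)"
    using shift_arrow_fibre n unfolding top by (auto simp: punit_def gfibre_def)
  have seg_cont: "continuous_map ?T (Mor \<Lambda>) (\<lambda>g. seg (fst g) r q)" if "r \<le> q" "q \<in> degs k" for r q
    using range_seg_continuous[OF that] by (rule continuous_map_from_subtopology)
  have "openin ?T (?f -` P \<inter> topspace ?T)" if P: "P \<in> path_groupoid_basis k \<Lambda>" for P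
  proof -
    obtain U V F m where U: "openin (Mor \<Lambda>) U" and V: "openin (Mor \<Lambda>) V" and F: "F \<subseteq> src_pairs \<Lambda>"
      "compactin (prod_topology (Mor \<Lambda>) (Mor \<Lambda>)) F"
      and P_eq: "P = Zset k \<Lambda> ((U \<times> V) \<inter> src_pairs \<Lambda>) m \<inter> (path_arrows k \<Lambda> - Zset k \<Lambda> F m)"
      using P unfolding path_groupoid_basis_def by blast
    show ?thesis
    proof (cases "m = deg_int n")
      case False
      then have "?f -` P \<inter> topspace ?T = {}"
        using n Zset_boundary[OF _ boundary_shift] unfolding top by (auto simp only: f P_eq vimage_def)
      then show ?thesis
        by (simp only: openin_empty)
    next
      case True
      define A where "A = (\<Union>q\<in>degs k. {g \<in> topspace ?T. seg (fst g) 0 (n + q) \<in> U} \<inter>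
          {g \<in> topspace ?T. seg (fst g) n (n + q) \<in> V})"
      \<comment> \<open>The second segment x(n, n+q) has degree \<open>q\<close>, so restricting
        \<open>q\<close> to the degrees of second components of \<open>F\<close> loses
        nothing.\<close>
      define C where "C = (\<Union>q\<in>degs k \<inter> (\<lambda>(a, b). deg \<Lambda> b) ` F.
          {g \<in> topspace ?T. (seg (fst g) 0 (n + q), seg (fst g) n (n + q)) \<in> F})"
      have Zset_iff: "?f (punit x) \<in> Zset k \<Lambda> E m \<longleftrightarrow> (\<exists>q\<in>degs k. (seg x 0 (n + q), seg x n (n + q)) \<in> E)"
        if "x \<in> bpaths" for x E
        using Zset_boundary[OF that boundary_shift[OF that n]] boundary_seg_shift[OF that n] lag_deg_int[OF that n]
        unfolding f True by auto
      have "?f -` P \<inter> topspace ?T = A - C"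
      proof (rule set_eqI)
        fix g
        show "g \<in> ?f -` P \<inter> topspace ?T \<longleftrightarrow> g \<in> A - C"
        proof (cases "g \<in> topspace ?T")
          case g: True
          then obtain x where x: "g = punit x" "x \<in> bpaths" "fst g = x"
            unfolding top by (metis imageE punit_def fst_conv)
          have "?f g \<in> path_arrows k \<Lambda>"
            using f_top g unfolding gtop_bgrp by (auto simp: topology_generated_by_topspace Union_path_groupoid_basis)
          then have "?f g \<in> P \<longleftrightarrow> (\<exists>q\<in>degs k. (seg x 0 (n + q), seg x n (n + q)) \<in> (U \<times> V) \<inter> src_pairs \<Lambda>) \<and>
              \<not> (\<exists>q\<in>degs k. (seg x 0 (n + q), seg x n (n + q)) \<in> F)"
            using Zset_iff[OF x(2)] by (simp add: P_eq x(1))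
          moreover have "(seg x 0 (n + q), seg x n (n + q)) \<in> src_pairs \<Lambda>" if "q \<in> degs k" for q
            using that x n lag_src_pairs[of x "shift k n x" "deg_int n" "n + q" q] boundary_seg_shift[of x n q]
            by (simp add: lag_deg_int)
          moreover have "q \<in> (\<lambda>(a, b). deg \<Lambda> b) ` F"
            if "q \<in> degs k" "(seg x 0 (n + q), seg x n (n + q)) \<in> F" for q
            using that n boundary_seg(2)[OF x(2) le_add_deg, of n q] by force
          then have "g \<in> C \<longleftrightarrow> (\<exists>q\<in>degs k. (seg x 0 (n + q), seg x n (n + q)) \<in> F)"
            using g unfolding C_def x(3)[symmetric] by blast
          moreover have "g \<in> A \<longleftrightarrow> (\<exists>q\<in>degs k. seg x 0 (n + q) \<in> U \<and> seg x n (n + q) \<in> V)"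
            using g unfolding A_def x(3)[symmetric] by blast
          ultimately show ?thesis
            using g unfolding Int_iff vimage_eq Diff_iff mem_Times_iff fst_conv snd_conv by blast
        qed (auto simp: A_def)
      qed
      moreover have "openin ?T A"
      proof -
        have "openin ?T {g \<in> topspace ?T. seg (fst g) 0 (n + q) \<in> U}"
          "openin ?T {g \<in> topspace ?T. seg (fst g) n (n + q) \<in> V}" if "q \<in> degs k" for q
          using that n by (intro openin_continuous_map_preimage[OF seg_cont] U V; simp)+
        then show ?thesis
          unfolding A_def by (intro openin_Union) blast
      qed
      moreover have "closedin ?T C"
      proof -
        have "closedin (prod_topology (Mor \<Lambda>) (Mor \<Lambda>)) F"
          using mor_space(3) by (intro compactin_imp_closedin[OF _ F(2)]) (simp add: Hausdorff_space_prod_topology)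
        then have "closedin ?T {g \<in> topspace ?T. (seg (fst g) 0 (n + q), seg (fst g) n (n + q)) \<in> F}" if "q \<in> degs k" for q
          using n that by (intro closedin_continuous_map_preimage[where Y = "prod_topology (Mor \<Lambda>) (Mor \<Lambda>)"]
              continuous_map_pairedI seg_cont) auto
        then show ?thesis
          unfolding C_def using finite_compact_degrees[OF F(2)] by (intro closedin_Union) auto
      qed
      ultimately show ?thesis
        by (simp only: openin_diff)
    qed
  qed
  moreover have "?f ` topspace ?T \<subseteq> \<Union> (path_groupoid_basis k \<Lambda>)"
    using f_top unfolding gtop_bgrp by (auto simp: topology_generated_by_topspace)
  ultimately have "continuous_map ?T (topology_generated_by (path_groupoid_basis k \<Lambda>)) ?f"
    by (intro continuous_on_generated_topo)
  then show ?thesis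
    using f_top by (subst (2) gtop_bgrp, intro continuous_map_into_subtopology) (auto simp: gtop_bgrp)
qed

text \<open>A boundary path is determined by its initial segments, so the fibre is an intersection
  of preimages of points of the Hausdorff morphism space under continuous maps.\<close>

lemma closedin_fibre:
  assumes x: "x \<in> bpaths"
  shows "closedin (gtop bgrp) (gfibre bgrp (punit x))"
proof -
  have "gfibre bgrp (punit x) = (\<Inter>p\<in>degs k. {g \<in> topspace (gtop bgrp). seg (fst g) 0 p \<in> {seg x 0 p}})"
  proof (intro equalityI subsetI)
    fix g assume "g \<in> (\<Inter>p\<in>degs k. {g \<in> topspace (gtop bgrp). seg (fst g) 0 p \<in> {seg x 0 p}})"
    then have g: "g \<in> topspace (gtop bgrp)" "\<And>p. p \<in> degs k \<Longrightarrow> seg (fst g) 0 p = seg x 0 p"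
      using zero_degs by blast+
    then have "fst g = x"
      using x bgrp_topspaceD by (intro boundary_path_eqI) auto
    then show "g \<in> gfibre bgrp (punit x)"
      using g(1) by (simp add: gfibre_bgrp)
  qed (auto simp: gfibre_bgrp)
  moreover have "closedin (gtop bgrp) {g \<in> topspace (gtop bgrp). seg (fst g) 0 p \<in> {seg x 0 p}}" if "p \<in> degs k" for p
    using range_seg_0_continuous[OF that] mor_space(3) boundary_seg_0(1)[OF x that]
    by (intro closedin_continuous_map_preimage) (auto simp: closedin_Hausdorff_singleton)
  moreover have "degs k \<noteq> ({} :: (nat \<Rightarrow> nat) set)"
    using zero_degs by blast
  ultimately show ?thesis
    by (simp only:) (intro closedin_Inter, auto)
qed

text \<open>Take \<open>U\<close> around y(0, q) on which the source map is injective. Another arrow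
  from \<open>x\<close> to some \<open>z\<close> with the same witnesses has the same shifted path,
  hence z(0, q) and y(0, q) have the same source. If both lie in \<open>U\<close> they agree, and
  with the shift they determine z = y.\<close>

lemma fibre_discrete:
  assumes g: "g \<in> gfibre bgrp (punit x)"
  shows "\<exists>T. openin (gtop bgrp) T \<and> T \<inter> gfibre bgrp (punit x) = {g}"
proof -
  obtain m y p q where gy: "g = (x, m, y)" "x \<in> bpaths" "y \<in> bpaths" "lag x m y p q"
    using g bgrp_topspace_iff by (cases g) (fastforce simp: gfibre_bgrp)
  let ?b = "seg y 0 q"
  have pq: "p \<in> degs k" "q \<in> degs k" and sh: "shift k p x = shift k q y"
    using gy(4) by (auto simp: lag_def)
  obtain U where U: "openin (Mor \<Lambda>) U" "?b \<in> U" "inj_on (src \<Lambda>) U"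
  proof -
    obtain U where U: "openin (Mor \<Lambda>) U" "?b \<in> U"
      "homeomorphic_map (subtopology (Mor \<Lambda>) U) (subtopology (Obj \<Lambda>) (src \<Lambda> ` U)) (src \<Lambda>)"
      using src_local_homeo boundary_seg_0(1)[OF gy(3) pq(2)] unfolding local_homeomorphism_def by blast
    then have "inj_on (src \<Lambda>) U"
      using homeomorphic_imp_injective_map[OF U(3)] openin_subset[OF U(1)] by (simp add: inf_absorb2)
    then show ?thesis
      using U that by blast
  qed
  \<comment> \<open>The two degree conditions pin the witnesses of any arrow in the basic set to
    \<open>p\<close> and \<open>q\<close>.\<close>
  let ?A = "{a \<in> mors \<Lambda>. deg \<Lambda> a = p}" and ?B = "U \<inter> {a \<in> mors \<Lambda>. deg \<Lambda> a = q}"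
  have "g \<in> basic_arrows ?A ?B m"
    using gy pq U boundary_seg_0[OF gy(2) pq(1)] boundary_seg_0[OF gy(3) pq(2)]
    unfolding gy(1) basic_arrows_iff by blast
  moreover have "h = g" if h: "h \<in> basic_arrows ?A ?B m" "h \<in> gfibre bgrp (punit x)" for h
  proof -
    obtain z p' q' where z: "h = (x, m, z)" "z \<in> bpaths" "lag x m z p' q'" "seg x 0 p' \<in> ?A" "seg z 0 q' \<in> ?B"
      using h unfolding basic_arrows_def gfibre_bgrp by auto
    then have d: "p' \<in> degs k" "q' \<in> degs k" "shift k p' x = shift k q' z"
      by (auto simp: lag_def)
    have "p' = p" "q' = q"
      using z boundary_seg_0(2)[OF gy(2) d(1)] boundary_seg_0(2)[OF z(2) d(2)] by auto
    then have eq: "shift k q z = shift k q y"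
      using d sh by simp
    have "src \<Lambda> (seg z 0 q) = src \<Lambda> ?b"
      using boundary_seg_0(3)[OF gy(3) pq(2)] boundary_seg_0(3)[OF z(2) pq(2)] eq by simp
    then have "seg z 0 q = ?b"
      using z(5) U \<open>q' = q\<close> by (auto dest: inj_onD)
    moreover have "pdeg y = pdeg z"
      using gy(3) z(2) by (simp add: boundary_pdeg)
    ultimately have "z = y"
      using boundary_xdeg[OF z(2) pq(2)] boundary_path_space[OF z(2)] boundary_path_space[OF gy(3)]
      by (intro path_head_shift_eqI[OF _ _ pq(2) _ _ _ eq])
    then show ?thesis
      using z gy by simp
  qed
  moreover have "openin (gtop bgrp) (basic_arrows ?A ?B m)"
    by (intro openin_basic_arrows openin_Int U openin_level)
  ultimately show ?thesis
    using g by (intro exI[where x = "basic_arrows ?A ?B m"]) blast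
qed

text \<open>The arrows that have some witness pair bounded by \<open>M\<close> form an open set,
  because fixing the degrees of both segments is an open condition. These sets increase with
  \<open>M\<close> and cover the groupoid, so a compact set lies in one of them.\<close>

lemma compact_bounded_lag:
  assumes K: "compactin (gtop bgrp) K"
  obtains M where "\<And>x m y. (x, m, y) \<in> K \<Longrightarrow> \<exists>p q. lag x m y p q \<and> (\<forall>i. p i \<le> M \<and> q i \<le> M)"
proof -
  define L where "L p = {a \<in> mors \<Lambda>. deg \<Lambda> a = p}" for p
  define W where "W M = (\<Union>(p, q)\<in>{(p, q). \<forall>i. p i \<le> M \<and> q i \<le> M}. \<Union>m. basic_arrows (L p) (L q) m)" for M :: nat
  have W_iff: "(x, m, y) \<in> W M \<longleftrightarrow>
      x \<in> bpaths \<and> y \<in> bpaths \<and> (\<exists>p q. lag x m y p q \<and> (\<forall>i. p i \<le> M \<and> q i \<le> M))" for x m y M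
  proof -
    have "seg x 0 p \<in> L p \<and> seg y 0 q \<in> L q" if "x \<in> bpaths" "y \<in> bpaths" "lag x m y p q" for p q
      using that boundary_seg_0[of x p] boundary_seg_0[of y q] by (simp add: L_def lag_def)
    moreover have "p' = p \<and> q' = q"
      if "x \<in> bpaths" "y \<in> bpaths" "lag x m y p' q'" "seg x 0 p' \<in> L p" "seg y 0 q' \<in> L q" for p q p' q'
      using that boundary_seg_0[of x p'] boundary_seg_0[of y q'] by (simp add: L_def lag_def)
    ultimately show ?thesis
      unfolding W_def by (simp add: basic_arrows_iff) blast
  qed
  have "openin (gtop bgrp) (W M)" for M
    unfolding W_def L_def by (intro openin_Union) (auto intro!: openin_basic_arrows openin_level)
  moreover have "K \<subseteq> \<Union> (range W)"
  proof
    fix g assume "g \<in> K"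
    then have "g \<in> topspace (gtop bgrp)"
      using compactin_subset_topspace[OF K] by blast
    then obtain x m y p q where g: "g = (x, m, y)" "x \<in> bpaths" "y \<in> bpaths" "lag x m y p q"
      using bgrp_topspace_iff by (metis prod_cases3)
    \<comment> \<open>The coordinate sum is a bound for all coordinates that makes sense for
      \<open>k = 0\<close> too.\<close>
    have *: "r i \<le> sum r {..<k}" if "r \<in> degs k" for i and r :: "nat \<Rightarrow> nat"
      using that by (cases "i < k") (auto simp: degs_def intro: member_le_sum)
    have "p i \<le> sum p {..<k} + sum q {..<k}" "q i \<le> sum p {..<k} + sum q {..<k}" for i
      using *[of p i] *[of q i] g(4) by (auto simp: lag_def)
    then have "g \<in> W (sum p {..<k} + sum q {..<k})"
      using g(2-4) unfolding g(1) W_iff by blast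
    then show "g \<in> \<Union> (range W)"
      by blast
  qed
  ultimately obtain \<F> where \<F>: "finite \<F>" "\<F> \<subseteq> range W" "K \<subseteq> \<Union>\<F>"
    using compactinD[OF K, of "range W"] by blast
  then obtain J where J: "finite J" "\<F> = W ` J"
    by (meson finite_subset_image)
  have "\<exists>p q. lag x m y p q \<and> (\<forall>i. p i \<le> Max J \<and> q i \<le> Max J)" if xK: "(x, m, y) \<in> K" for x m y
  proof -
    obtain j where j: "j \<in> J" "(x, m, y) \<in> W j"
      using xK \<F>(3) J(2) by blast
    then show ?thesis
      using Max_ge[OF J(1) j(1)] unfolding W_iff by (meson order.trans)
  qed
  then show ?thesis
    using that by blast
qed

end

section \<open>Approximately invariant means\<close>

lemma sum_card_disjoint_le:
  assumes "finite P" "disjoint P" "finite D"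
  shows "(\<Sum>A\<in>P. card {n \<in> D. f n \<in> A}) \<le> card D"
proof -
  have "(\<Sum>A\<in>P. card {n \<in> D. f n \<in> A}) = card (\<Union>A\<in>P. {n \<in> D. f n \<in> A})"
    using assms by (intro card_UN_disjoint[symmetric]) (auto simp: disjoint_def)
  also have "\<dots> \<le> card D"
    using assms by (intro card_mono) auto
  finally show ?thesis .
qed

text \<open>The point masses with index in \<open>S\<close> cancel against those with index in its
  image under \<open>\<tau>\<close>. On each side \<open>card B - card S\<close> masses remain, and
  a disjoint family counts each of them at most once, whence the factor 2. Counting indices rather
  than values takes care of possible coincidences among the values of \<open>f\<close> or
  \<open>h\<close>.\<close>

lemma tv_dist_uniform_le:
  assumes B: "finite B" "B \<noteq> {}"
    and M: "\<And>A. A \<in> sets M \<Longrightarrow> measure M A = card {n \<in> B. f n \<in> A} / card B"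
    and N: "\<And>A. A \<in> sets M \<Longrightarrow> measure N A = card {n \<in> B. h n \<in> A} / card B"
    and S: "S \<subseteq> B" "inj_on \<tau> S" "\<tau> ` S \<subseteq> B" "\<And>n. n \<in> S \<Longrightarrow> f n = h (\<tau> n)"
  shows "tv_dist M N \<le> 2 * (1 - card S / card B)"
proof -
  have fin: "finite S" "finite (\<tau> ` S)"
    using B(1) S(1,3) finite_subset by blast+
  have B0: "card B > 0"
    using B by (simp add: card_gt_0_iff)
  have split: "card {n \<in> B. u n \<in> A} = card {n \<in> R. u n \<in> A} + card {n \<in> B - R. u n \<in> A}"
    if "R \<subseteq> B" for u A R
  proof -
    have "card ({n \<in> R. u n \<in> A} \<union> {n \<in> B - R. u n \<in> A}) = card {n \<in> R. u n \<in> A} + card {n \<in> B - R. u n \<in> A}"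
      using that B(1) finite_subset[OF that B(1)] by (intro card_Un_disjoint) auto
    moreover have "{n \<in> R. u n \<in> A} \<union> {n \<in> B - R. u n \<in> A} = {n \<in> B. u n \<in> A}"
      using that by auto
    ultimately show ?thesis
      by simp
  qed
  have same: "card {n \<in> S. f n \<in> A} = card {n \<in> \<tau> ` S. h n \<in> A}" for A
  proof -
    have "{n \<in> \<tau> ` S. h n \<in> A} = \<tau> ` {n \<in> S. f n \<in> A}"
      using S(4) by auto
    moreover have "inj_on \<tau> {n \<in> S. f n \<in> A}"
      using S(2) by (rule inj_on_subset) auto
    ultimately show ?thesis
      by (simp add: card_image)
  qed
  have le: "\<bar>measure M A - measure N A\<bar> \<le>
      real (card {n \<in> B - S. f n \<in> A} + card {n \<in> B - \<tau> ` S. h n \<in> A}) / card B"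
    if "A \<in> sets M" for A
  proof -
    have "measure M A - measure N A =
        (real (card {n \<in> B - S. f n \<in> A}) - real (card {n \<in> B - \<tau> ` S. h n \<in> A})) / card B"
      unfolding M[OF that] N[OF that] split[OF S(1), of f] split[OF S(3), of h] same
      by (simp add: add_divide_distrib diff_divide_distrib)
    then show ?thesis
      using B0 by (simp add: divide_right_mono abs_divide)
  qed
  have "(\<Sum>A\<in>P. \<bar>measure M A - measure N A\<bar>) \<le> 2 * (1 - card S / card B)"
    if P: "finite P" "P \<subseteq> sets M" "disjoint P" for P
  proof -
    have "(\<Sum>A\<in>P. \<bar>measure M A - measure N A\<bar>) \<le>
        (\<Sum>A\<in>P. real (card {n \<in> B - S. f n \<in> A} + card {n \<in> B - \<tau> ` S. h n \<in> A}) / card B)"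
      using P(2) le by (intro sum_mono) auto
    also have "\<dots> = real ((\<Sum>A\<in>P. card {n \<in> B - S. f n \<in> A}) + (\<Sum>A\<in>P. card {n \<in> B - \<tau> ` S. h n \<in> A})) / card B"
      by (simp add: sum.distrib flip: sum_divide_distrib)
    also have "\<dots> \<le> real (card (B - S) + card (B - \<tau> ` S)) / card B"
      using B(1) P by (intro divide_right_mono of_nat_mono add_mono sum_card_disjoint_le) auto
    also have "\<dots> = (2 * real (card B) - 2 * real (card S)) / card B"
      using fin S B(1) card_mono[OF B(1) S(1)] by (simp add: card_Diff_subset card_image of_nat_diff)
    also have "\<dots> = 2 * (1 - card S / card B)"
      using B0 by (simp add: field_simps)
    finally show ?thesis .
  qed
  \<comment> \<open>The empty family shows that the supremum ranges over a nonempty set, as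
    \<open>cSUP_least\<close> requires.\<close>
  moreover have "{} \<in> {P. finite P \<and> P \<subseteq> sets M \<and> disjoint P}"
    by (simp add: disjoint_def)
  ultimately show ?thesis
    unfolding tv_dist_def by (intro cSUP_least) (blast, simp)
qed

section \<open>Borel sets of an abstract topology\<close>

lemma space_Borel_of [simp]: "space (Borel_of T) = topspace T"
  unfolding Borel_of_def by (rule space_measure_of) (auto dest: openin_subset)

lemma sets_Borel_of: "sets (Borel_of T) = sigma_sets (topspace T) {U. openin T U}"
  unfolding Borel_of_def by (rule sets_measure_of) (auto dest: openin_subset)

lemma openin_Borel_of: "openin T U \<Longrightarrow> U \<in> sets (Borel_of T)"
  by (simp add: sets_Borel_of sigma_sets.Basic)

lemma closedin_Borel_of:
  assumes "closedin T C"
  shows "C \<in> sets (Borel_of T)"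
proof -
  have "topspace T - (topspace T - C) \<in> sets (Borel_of T)"
    using assms by (intro sets.Diff openin_Borel_of) (auto simp: closedin_def)
  then show ?thesis
    using closedin_subset[OF assms] by (simp add: double_diff)
qed

lemma continuous_map_Borel_of:
  assumes "continuous_map T euclidean f"
  shows "f \<in> borel_measurable (Borel_of T)"
proof (rule borel_measurableI)
  fix S :: "'b set" assume "open S"
  then have "openin T {x \<in> topspace T. f x \<in> S}"
    using assms by (simp add: continuous_map_def)
  moreover have "f -` S \<inter> space (Borel_of T) = {x \<in> topspace T. f x \<in> S}"
    by auto
  ultimately show "f -` S \<inter> space (Borel_of T) \<in> sets (Borel_of T)"
    by (simp add: openin_Borel_of)
qed

text \<open>The default value 0 beyond \<open>k\<close> puts the functions into
  \<open>degs k\<close>. For \<open>k = 0\<close> the box consists of the zero degree alone, in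
  accordance with the cardinality \<open>N ^ k\<close>.\<close>

definition deg_box :: "nat \<Rightarrow> nat \<Rightarrow> (nat \<Rightarrow> nat) set" where
  "deg_box k N = PiE_dflt {..<k} 0 (\<lambda>_. {..<N})"

lemma deg_box_iff: "n \<in> deg_box k N \<longleftrightarrow> n \<in> degs k \<and> (\<forall>i<k. n i < N)"
  unfolding deg_box_def PiE_dflt_def degs_def mem_Collect_eq lessThan_iff not_less by blast

lemma finite_deg_box [simp]: "finite (deg_box k N)"
  by (simp add: deg_box_def finite_PiE_dflt)

lemma card_deg_box: "card (deg_box k N) = N ^ k"
  by (simp add: deg_box_def card_PiE_dflt)

lemma deg_box_nonempty: "N > 0 \<Longrightarrow> deg_box k N \<noteq> {}"
  using card_deg_box[of k N] by (metis card.empty not_less0 zero_less_power)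

lemma uniform_count_measure_integral:
  fixes f :: "'a \<Rightarrow> complex"
  assumes "finite B"
  shows "integral\<^sup>L (uniform_count_measure B) f = (\<Sum>n\<in>B. (1 / card B) *\<^sub>R f n)"
  unfolding uniform_count_measure_def using assms
  by (subst lebesgue_integral_point_measure_finite) simp_all

context proper_kgraph_no_sources
begin

text \<open>A translated measure is a push-forward along left multiplication on a fibre, which is
  meaningful only if the fibre and this map are measurable; fibres being closed and discrete,
  all their subsets are Borel.\<close>

lemma fibre_subset_Borel:
  assumes x: "x \<in> bpaths" and A: "A \<subseteq> gfibre bgrp (punit x)"
  shows "A \<in> sets (Borel_of (gtop bgrp))"
proof -
  have "\<forall>g\<in>gfibre bgrp (punit x). \<exists>T. openin (gtop bgrp) T \<and> T \<inter> gfibre bgrp (punit x) = {g}"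
    using fibre_discrete by blast
  from bchoice[OF this] obtain T
    where T: "\<And>g. g \<in> gfibre bgrp (punit x) \<Longrightarrow> openin (gtop bgrp) (T g) \<and> T g \<inter> gfibre bgrp (punit x) = {g}"
    by blast
  have "(\<Union>g\<in>A. T g) \<inter> gfibre bgrp (punit x) = (\<Union>g\<in>A. T g \<inter> gfibre bgrp (punit x))"
    by blast
  also have "\<dots> = (\<Union>g\<in>A. {g})"
  proof (rule SUP_cong[OF refl])
    fix g assume "g \<in> A"
    then have "g \<in> gfibre bgrp (punit x)"
      using A by (rule rev_subsetD)
    then show "T g \<inter> gfibre bgrp (punit x) = {g}"
      by (rule conjunct2[OF T])
  qed
  finally have "A = (\<Union>g\<in>A. T g) \<inter> gfibre bgrp (punit x)"
    by simp
  moreover have "openin (gtop bgrp) (\<Union>g\<in>A. T g)"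
    using A T by (intro openin_Union) blast
  ultimately show ?thesis
    using closedin_fibre[OF x] by (metis sets.Int openin_Borel_of closedin_Borel_of)
qed

section \<open>The averages over boxes and their translates\<close>

definition follow_measure :: "nat \<Rightarrow> 'a kpath \<Rightarrow> 'a path_arrow measure" where
  "follow_measure N x = distr (uniform_count_measure (deg_box k N)) (Borel_of (gtop bgrp)) (shift_arrow x)"

lemma shift_arrow_measurable:
  assumes "x \<in> bpaths"
  shows "shift_arrow x \<in> measurable (uniform_count_measure (deg_box k N)) (Borel_of (gtop bgrp))"
  using shift_arrow_fibre[OF assms]
  by (auto simp: measurable_def space_uniform_count_measure sets_uniform_count_measure deg_box_iff gfibre_def)

lemma sets_follow_measure [simp]: "sets (follow_measure N x) = sets (Borel_of (gtop bgrp))"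
  by (simp add: follow_measure_def)

lemma emeasure_follow_measure:
  assumes "x \<in> bpaths" "A \<in> sets (Borel_of (gtop bgrp))"
  shows "emeasure (follow_measure N x) A = emeasure (uniform_count_measure (deg_box k N)) {n \<in> deg_box k N. shift_arrow x n \<in> A}"
  unfolding follow_measure_def
  by (subst emeasure_distr[OF shift_arrow_measurable[OF assms(1)] assms(2)])
    (auto simp: space_uniform_count_measure intro!: arg_cong2[where f = emeasure])

lemma measure_follow_measure:
  assumes "x \<in> bpaths" "A \<in> sets (Borel_of (gtop bgrp))"
  shows "measure (follow_measure N x) A = card {n \<in> deg_box k N. shift_arrow x n \<in> A} / card (deg_box k N)"
proof -
  have "measure (follow_measure N x) A = measure (uniform_count_measure (deg_box k N)) {n \<in> deg_box k N. shift_arrow x n \<in> A}"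
    unfolding measure_def emeasure_follow_measure[OF assms] ..
  also have "\<dots> = card {n \<in> deg_box k N. shift_arrow x n \<in> A} / card (deg_box k N)"
    by (intro measure_uniform_count_measure) auto
  finally show ?thesis .
qed

text \<open>The averages are carried by a range fibre all of whose subsets are Borel, so restriction
  to the fibre and push-forward under left multiplication both reduce to counting indices in the
  box.\<close>

lemma measure_translate_follow:
  assumes g: "(x, m, y) \<in> topspace (gtop bgrp)" and A: "A \<in> sets (Borel_of (gtop bgrp))"
  shows "measure (translate bgrp (x, m, y) (follow_measure N y)) A =
         card {n \<in> deg_box k N. gmult bgrp (x, m, y) (shift_arrow y n) \<in> A} / card (deg_box k N)"
proof -
  let ?F = "gfibre bgrp (punit y)" and ?h = "gmult bgrp (x, m, y)" and ?\<mu> = "follow_measure N y"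
  have y: "y \<in> bpaths" and x: "x \<in> bpaths"
    using g by (simp_all add: bgrp_topspace_iff)
  have F: "?F \<in> sets ?\<mu>"
    using fibre_subset_Borel[OF y order.refl] by simp
  have h_top: "?h g \<in> topspace (gtop bgrp)" if "g \<in> ?F" for g
  proof -
    obtain m' z p' q' where z: "g = (y, m', z)" "z \<in> bpaths" "lag y m' z p' q'"
      using \<open>g \<in> ?F\<close> bgrp_topspace_iff by (cases g) (fastforce simp: gfibre_bgrp)
    obtain p q where pq: "lag x m y p q"
      using g bgrp_topspace_iff by blast
    \<comment> \<open>Both witness pairs are enlarged until they use the same degree
      \<open>q + p'\<close> at the middle path \<open>y\<close>; then the shifted paths of
      \<open>x\<close> and \<open>z\<close> coincide.\<close>
    have "lag x m y (p + p') (q + p')" "lag y m' z (p' + q) (q' + q)"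
      using lag_add[OF x y pq] lag_add[OF y z(2,3)] pq z(3) by (auto simp: lag_def)
    then have "lag x (m + m') z (p + p') (q' + q)"
      by (auto simp: lag_def add.commute)
    then show ?thesis
      unfolding z(1) bgrp_simps bgrp_topspace_iff using x z(2) by blast
  qed
  have h: "?h \<in> measurable (restrict_space ?\<mu> ?F) (Borel_of (gtop bgrp))"
  proof (rule measurableI)
    fix g assume "g \<in> space (restrict_space ?\<mu> ?F)"
    then show "?h g \<in> space (Borel_of (gtop bgrp))"
      using h_top by (simp add: space_restrict_space)
  next
    fix A
    have "?h -` A \<inter> ?F \<in> sets ?\<mu>"
      using fibre_subset_Borel[OF y, of "?h -` A \<inter> ?F"] by simp
    moreover have "space ?\<mu> \<inter> ?F = ?F"
      using sets.sets_into_space[OF F] by blast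
    ultimately show "?h -` A \<inter> space (restrict_space ?\<mu> ?F) \<in> sets (restrict_space ?\<mu> ?F)"
      using F by (simp add: space_restrict_space sets_restrict_space_iff)
  qed
  have "measure (translate bgrp (x, m, y) ?\<mu>) A = measure (restrict_space ?\<mu> ?F) (?h -` A \<inter> space (restrict_space ?\<mu> ?F))"
    unfolding translate_def bgrp_simps by (rule measure_distr[OF h A])
  also have "\<dots> = measure (restrict_space ?\<mu> ?F) (?h -` A \<inter> ?F)"
    using sets.sets_into_space[OF F] by (simp add: space_restrict_space inf_absorb1 inf_absorb2)
  also have "\<dots> = measure ?\<mu> (?h -` A \<inter> ?F)"
    using F sets.sets_into_space[OF F] by (intro measure_restrict_space) (auto simp: inf_absorb1 inf_absorb2)
  also have "\<dots> = card {n \<in> deg_box k N. shift_arrow y n \<in> ?h -` A \<inter> ?F} / card (deg_box k N)"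
    using fibre_subset_Borel[OF y, of "?h -` A \<inter> ?F"] by (intro measure_follow_measure[OF y]) simp
  also have "{n \<in> deg_box k N. shift_arrow y n \<in> ?h -` A \<inter> ?F} = {n \<in> deg_box k N. ?h (shift_arrow y n) \<in> A}"
    using shift_arrow_fibre[OF y] by (auto simp: deg_box_iff)
  finally show ?thesis .
qed

text \<open>Integration against the measure is a finite average of values of \<open>f\<close> at
  shift arrows, with weights independent of the path, so continuity follows from
  \<open>shift_arrow_continuous\<close>. Positivity of \<open>N\<close> keeps the box nonempty and
  the total mass 1.\<close>

lemma continuous_follow_system:
  assumes N: "N > 0"
  shows "continuous_prob_system bgrp (\<lambda>u. follow_measure N (fst u))"
  unfolding continuous_prob_system_def
proof (intro conjI ballI)
  fix u assume "u \<in> gunits bgrp"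
  then obtain x where x: "u = punit x" "x \<in> bpaths" "fst u = x"
    unfolding gunits_bgrp by (metis imageE punit_def fst_conv)
  show "prob_space (follow_measure N (fst u))"
    unfolding x(3) follow_measure_def using deg_box_nonempty[OF N] shift_arrow_measurable[OF x(2)]
    by (intro prob_space.prob_space_distr prob_space_uniform_count_measure) auto
  show "sets (follow_measure N (fst u)) = sets (Borel_of (gtop bgrp))"
    by simp
  have "{g \<in> space (Borel_of (gtop bgrp)). g \<in> gfibre bgrp u} = gfibre bgrp u"
    by (auto simp: gfibre_def)
  then show "AE g in follow_measure N (fst u). g \<in> gfibre bgrp u"
    unfolding x(3) follow_measure_def
    using fibre_subset_Borel[OF x(2) order.refl] shift_arrow_fibre[OF x(2)] x(1)
    by (subst AE_distr_iff[OF shift_arrow_measurable[OF x(2)]])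
      (auto simp: space_uniform_count_measure deg_box_iff intro!: AE_I2)
next
  fix f assume "f \<in> Cc (gtop bgrp)"
  then have f: "continuous_map (gtop bgrp) euclidean f"
    by (simp add: Cc_def)
  let ?T = "subtopology (gtop bgrp) (gunits bgrp)" and ?B = "deg_box k N"
  have "continuous_map ?T euclidean (\<lambda>u. f (shift_arrow (fst u) n))" if "n \<in> ?B" for n
    using continuous_map_compose[OF shift_arrow_continuous f, of n] that by (simp add: deg_box_iff comp_def)
  \<comment> \<open>\<open>?T\<close> is an abstract topology, so continuity is rephrased through
    the filters \<open>atin\<close>, to which the limit rules for sums and scalar multiples
    apply.\<close>
  then have "continuous_map ?T euclidean (\<lambda>u. \<Sum>n\<in>?B. (1 / card ?B) *\<^sub>R f (shift_arrow (fst u) n))"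
    by (auto simp: continuous_map_atin intro!: tendsto_sum tendsto_scaleR tendsto_const)
  moreover have "integral\<^sup>L (follow_measure N (fst u)) f = (\<Sum>n\<in>?B. (1 / card ?B) *\<^sub>R f (shift_arrow (fst u) n))"
    if "u \<in> topspace ?T" for u
  proof -
    have "fst u \<in> bpaths"
      using that by (auto intro: bgrp_topspaceD)
    then show ?thesis
      unfolding follow_measure_def
      by (subst integral_distr[OF shift_arrow_measurable continuous_map_Borel_of[OF f]])
        (simp_all add: uniform_count_measure_integral)
  qed
  ultimately show "continuous_map ?T euclidean (\<lambda>u. integral\<^sup>L (follow_measure N (fst u)) f)"
    by (rule continuous_map_eq[OF _ sym])
qed

text \<open>With \<open>p\<close>, \<open>q\<close> as in \<open>lag x m y p q\<close>, the translate by \<open>(x, m, y)\<close> of the arrow from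
  \<open>y\<close> with index \<open>n \<ge> q\<close> is the arrow from \<open>x\<close> with index \<open>n - q + p\<close>.\<close>

lemma tv_dist_follow_le:
  assumes g: "(x, m, y) \<in> topspace (gtop bgrp)" and lag: "lag x m y p q"
    and M: "\<And>i. p i \<le> M" "\<And>i. q i \<le> M" and N: "2 * M < N"
  shows "tv_dist (translate bgrp (x, m, y) (follow_measure N y)) (follow_measure N x) \<le>
         2 * (1 - (1 - 2 * real M / real N) ^ k)"
proof -
  let ?B = "deg_box k N"
  \<comment> \<open>The lower margin \<open>M\<close> ensures \<open>q \<le> n\<close>, so that
    \<open>n - q\<close> is a true difference; the upper margin \<open>M\<close> leaves room for
    adding \<open>p\<close> without leaving the box.\<close>
  define S where "S = PiE_dflt {..<k} 0 (\<lambda>_. {M..<N - M})"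
  define \<tau> where "\<tau> n = (n - q) + p" for n :: "nat \<Rightarrow> nat"
  have x: "x \<in> bpaths" and y: "y \<in> bpaths"
    using g by (simp_all add: bgrp_topspace_iff)
  have pq: "p \<in> degs k" "q \<in> degs k" "m = deg_int p - deg_int q" "shift k p x = shift k q y"
    using lag by (auto simp: lag_def)
  have S: "n \<in> degs k" "q \<le> n" "n \<in> ?B" "\<tau> n \<in> ?B" if "n \<in> S" for n
  proof -
    have 1: "M \<le> n i" "n i < N - M" if "i < k" for i
      using that \<open>n \<in> S\<close> by (auto simp: S_def PiE_dflt_def)
    show 2: "n \<in> degs k"
      using \<open>n \<in> S\<close> by (auto simp: S_def PiE_dflt_def degs_def)
    show "q \<le> n"
    proof (rule le_funI)
      fix i show "q i \<le> n i"
        using 1[of i] M(2)[of i] pq(2) by (cases "i < k") (auto simp: degs_def)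
    qed
    show "n \<in> ?B"
      using 1(2) 2 by (force simp: deg_box_iff)
    have "\<tau> n i < N" if "i < k" for i
      using 1[OF that] M(1)[of i] by (simp add: \<tau>_def)
    then show "\<tau> n \<in> ?B"
      using 2 pq by (simp add: deg_box_iff \<tau>_def)
  qed
  have "tv_dist (translate bgrp (x, m, y) (follow_measure N y)) (follow_measure N x) \<le> 2 * (1 - card S / card ?B)"
  proof (rule tv_dist_uniform_le[where f = "\<lambda>n. gmult bgrp (x, m, y) (shift_arrow y n)" and h = "shift_arrow x" and \<tau> = \<tau>])
    show "finite ?B" "?B \<noteq> {}"
      using N deg_box_nonempty by auto
    show "inj_on \<tau> S"
    proof (rule inj_onI)
      fix n n' assume n: "n \<in> S" "n' \<in> S" "\<tau> n = \<tau> n'"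
      then have "n - q = n' - q"
        by (simp add: \<tau>_def)
      then show "n = n'"
        using deg_add_diff[OF S(2)[OF n(1)]] deg_add_diff[OF S(2)[OF n(2)]] by metis
    qed
    fix n assume n: "n \<in> S"
    have q: "q + (n - q) = n"
      using S(2)[OF n] by (rule deg_add_diff)
    have "shift k (\<tau> n) x = shift k (n - q) (shift k p x)"
      using boundary_shift_shift[OF x pq(1), of "n - q"] S(1)[OF n] by (simp add: \<tau>_def add.commute)
    also have "\<dots> = shift k n y"
      using boundary_shift_shift[OF y pq(2), of "n - q"] S(1)[OF n] q by (simp add: pq(4))
    finally have "shift k (\<tau> n) x = shift k n y" .
    moreover have "m + deg_int n = deg_int (\<tau> n)"
    proof (rule ext)
      fix i show "(m + deg_int n) i = deg_int (\<tau> n) i"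
        using le_funD[OF S(2)[OF n], of i] by (simp add: pq(3) deg_int_def \<tau>_def of_nat_diff)
    qed
    ultimately show "gmult bgrp (x, m, y) (shift_arrow y n) = shift_arrow x (\<tau> n)"
      by (simp add: shift_arrow_def)
  qed (use S measure_follow_measure[OF x] measure_translate_follow[OF g] in \<open>auto simp: translate_def\<close>)
  also have "real (card S) / real (card ?B) = (1 - 2 * real M / real N) ^ k"
  proof -
    have "card S = (N - 2 * M) ^ k"
      by (simp add: S_def card_PiE_dflt mult_2)
    \<comment> \<open>Since \<open>2 * M < N\<close>, the truncated difference of naturals agrees
      with the real one.\<close>
    moreover have "real (N - 2 * M) / real N = 1 - 2 * real M / real N"
      using N by (simp add: of_nat_diff field_simps)
    ultimately show ?thesis
      by (simp add: card_deg_box flip: power_divide)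
  qed
  finally show ?thesis .
qed

lemma bgrp_amenable: "amenable_groupoid bgrp"
  unfolding amenable_groupoid_def
proof (intro exI conjI allI impI ballI)
  \<comment> \<open>The sequence of averages is encoded in the prescribed index type: the set
    component is a dummy, the number \<open>N\<close> sits in the real component and is recovered by
    \<open>nat\<close> and the floor.\<close>
  let ?I = "{({} :: 'a path_arrow set, real N) |N. N > 0}"
  let ?le = "\<lambda>i j :: 'a path_arrow set \<times> real. snd i \<le> snd j"
  let ?m = "\<lambda>(i :: 'a path_arrow set \<times> real) u. follow_measure (nat \<lfloor>snd i\<rfloor>) (fst u)"
  show "directed_set ?I ?le"
    unfolding directed_set_def
  proof (intro conjI ballI impI)
    show "?I \<noteq> {}"
      by (auto intro!: exI[where x = "1 :: nat"])
    fix i j assume "i \<in> ?I" "j \<in> ?I"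
    then show "\<exists>l\<in>?I. ?le i l \<and> ?le j l"
      using linear[of "snd i" "snd j"] by blast
  qed auto
  show "continuous_prob_system bgrp (?m i)" if "i \<in> ?I" for i
    using that continuous_follow_system by auto
  fix K and \<epsilon> :: real assume K: "compactin (gtop bgrp) K" and \<epsilon>: "\<epsilon> > 0"
  obtain M where M: "\<And>x m y. (x, m, y) \<in> K \<Longrightarrow> \<exists>p q. lag x m y p q \<and> (\<forall>i. p i \<le> M \<and> q i \<le> M)"
    using compact_bounded_lag[OF K] by blast
  have "(\<lambda>N. 2 * (1 - (1 - 2 * real M / real N) ^ k)) \<longlonglongrightarrow> 2 * (1 - (1 - 0) ^ k)"
    by (intro tendsto_intros lim_const_over_n)
  then have "eventually (\<lambda>N. 2 * (1 - (1 - 2 * real M / real N) ^ k) < \<epsilon>) sequentially"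
    using \<epsilon> by (intro order_tendstoD(2)) simp_all
  then obtain N0 where N0: "\<And>N. N \<ge> N0 \<Longrightarrow> 2 * (1 - (1 - 2 * real M / real N) ^ k) < \<epsilon>"
    by (auto simp: eventually_sequentially)
  show "\<exists>i0\<in>?I. \<forall>i\<in>?I. ?le i0 i \<longrightarrow> (\<forall>g\<in>K. tv_dist (translate bgrp g (?m i (gsrc bgrp g))) (?m i (grng bgrp g)) < \<epsilon>)"
  \<comment> \<open>\<open>N0\<close> secures the tolerance; the summand \<open>2 * M + 1\<close>
    gives \<open>2 * M < N\<close> for all later indices, as the estimate for the box
    demands.\<close>
  proof (intro bexI[where x = "({}, real (N0 + 2 * M + 1))"] ballI impI)
    fix i g assume "i \<in> ?I" and le: "?le ({}, real (N0 + 2 * M + 1)) i" and g: "g \<in> K"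
    then obtain N where N: "i = ({}, real N)" "N \<ge> N0" "2 * M < N"
      by auto
    obtain x m y where xy: "g = (x, m, y)"
      using prod_cases3 by blast
    obtain p q where "lag x m y p q" "\<And>i. p i \<le> M" "\<And>i. q i \<le> M"
      using M g unfolding xy by blast
    then have "tv_dist (translate bgrp g (follow_measure N y)) (follow_measure N x) < \<epsilon>"
      unfolding xy using g xy compactin_subset_topspace[OF K] N0[OF N(2)] N(3)
      by (intro order.strict_trans1[OF tv_dist_follow_le]) auto
    then show "tv_dist (translate bgrp g (?m i (gsrc bgrp g))) (?m i (grng bgrp g)) < \<epsilon>"
      by (simp add: xy N(1) punit_def)
  qed (auto intro!: exI[where x = "N0 + 2 * M + 1"])
qed

end

theorem theorem6p8:
  fixes k :: nat and \<Lambda> :: "'a kgraph"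
  assumes "topological_kgraph k \<Lambda>"
    and "proper_kgraph k \<Lambda>"
    and "\<And>v. v \<in> objs \<Lambda> \<Longrightarrow> \<not> is_source k \<Lambda> v"
  shows "amenable_groupoid (boundary_path_groupoid k \<Lambda>)"
  by (rule proper_kgraph_no_sources.bgrp_amenable[OF proper_kgraph_no_sources.intro[OF
        assms(1) proper_kgraph_no_sources_axioms.intro[OF assms(2,3)]]])

end
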